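(* Let $\mu>0$, $n=\lfloor\mu\rfloor+1$, $s\in\mathbb{R}$, let $\Psi\in C^1([a,b])$ be an increasing positive function on $[a,b]\subset\mathbb{R}$ with $\Psi'(x)\neq0$ for all $x\in[a,b]$, and let $g\in AC^{n}_{\delta^{\Psi},s}[a,b]$. Then the Hadamard-type fractional derivative ${}^{HR}_{a}D^{\mu,s}_{\Psi(x)}g(x)$ of $g$ with respect to $\Psi$ exists almost everywhere on $[a,b]$, and it may be represented in the form $${}^{HR}_{a}D^{\mu,s}_{\Psi(x)}g(x)=\Psi(x)^{-s}\left[\frac{1}{\Gamma(n-\mu)}\int_a^x\left(\log\frac{\Psi(x)}{\Psi(t)}\right)^{n-\mu-1}g_{n-1}'(t)\,dt+\sum_{k=0}^{n-1}\frac{g_k(a)}{\Gamma(k-\mu+1)}\left(\log\frac{\Psi(x)}{\Psi(a)}\right)^{k-\mu}\right],$$ where $$g_k(x)=\left(\frac{\Psi(x)}{\Psi'(x)}\frac{d}{dx}\right)^k\big[\Psi(x)^sg(x)\big],\qquad k=0,1,\dots,n-1.$$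
   Context: The function space is $$AC^{n}_{\delta^{\Psi},s}[a,b]=\left\{h:[a,b]\to\mathbb{C}:\ \left(\frac{\Psi(x)}{\Psi'(x)}\frac{d}{dx}\right)^{n-1}\big[\Psi(x)^sh(x)\big]\in AC[a,b]\right\},$$ where $AC[a,b]$ is the set of absolutely continuous functions on $[a,b]$. Hadamard-type operators with respect to $\Psi$: for $\mu>0$, $${}^{H}_{a}I^{\mu,s}_{\Psi(x)}f(x)=\frac{1}{\Gamma(\mu)}\int_{a}^{x}\left(\frac{\Psi(t)}{\Psi(x)}\right)^{s}\left(\log\frac{\Psi(x)}{\Psi(t)}\right)^{\mu-1}f(t)\frac{\Psi'(t)}{\Psi(t)}\,dt,$$ and for $\mu>0$ with $n=\lfloor\mu\rfloor+1$, $${}^{HR}_{a}D^{\mu,s}_{\Psi(x)}f(x)=\Psi(x)^{-s}\left(\frac{\Psi(x)}{\Psi'(x)}\frac{d}{dx}\right)^{n}\Big[\Psi(x)^{s}\,{}^{H}_{a}I^{n-\mu,s}_{\Psi(x)}f(x)\Big].$$ The value $1/\Gamma(z)$ is $0$ when $z$ is a nonpositive integer. *)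

theory Defs
  imports "HOL-Analysis.Analysis"
begin

text \<open>
  Throughout, \<open>\<Psi>'\<close> is a separate argument that stands for the derivative of \<open>\<Psi>\<close> on \<open>[a, b]\<close>, and
  derivatives on \<open>[a, b]\<close> are taken within \<open>[a, b]\<close>, i.e. one-sidedly at the end points.
\<close>

definition abs_continuous_on_interval :: "real \<Rightarrow> real \<Rightarrow> (real \<Rightarrow> 'a::real_normed_vector) \<Rightarrow> bool" where
  "abs_continuous_on_interval a b f \<longleftrightarrow>
     (\<forall>\<epsilon>>0. \<exists>\<delta>>0. \<forall>I :: (real \<times> real) set.
        finite I \<and> (\<forall>(c, d) \<in> I. a \<le> c \<and> c \<le> d \<and> d \<le> b) \<and>
        disjoint_family_on (\<lambda>(c, d). {c<..<d}) I \<and> (\<Sum>(c, d)\<in>I. d - c) < \<delta>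
        \<longrightarrow> (\<Sum>(c, d)\<in>I. norm (f d - f c)) < \<epsilon>)"

text \<open>
  The value of \<open>(\<Psi>/\<Psi>' \<cdot> d/dx)\<^sup>k f\<close> at \<open>x\<close>; meaningful only where \<open>delta_exists\<close> below holds.
\<close>

primrec delta_pow ::
  "real \<Rightarrow> real \<Rightarrow> (real \<Rightarrow> real) \<Rightarrow> (real \<Rightarrow> real) \<Rightarrow> nat \<Rightarrow> (real \<Rightarrow> complex) \<Rightarrow> real \<Rightarrow> complex" where
  "delta_pow a b \<Psi> \<Psi>' 0 f = f"
| "delta_pow a b \<Psi> \<Psi>' (Suc k) f =
     (\<lambda>x. (\<Psi> x / \<Psi>' x) *\<^sub>R vector_derivative (delta_pow a b \<Psi> \<Psi>' k f) (at x within {a..b}))"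

text \<open>
  The \<open>(k+1)\<close>-st iterate exists at \<open>x\<close> iff the \<open>k\<close>-th one exists at \<open>x\<close> and at all nearby points
  of \<open>[a, b]\<close>, and is differentiable at \<open>x\<close>.
\<close>

primrec delta_exists ::
  "real \<Rightarrow> real \<Rightarrow> (real \<Rightarrow> real) \<Rightarrow> (real \<Rightarrow> real) \<Rightarrow> nat \<Rightarrow> (real \<Rightarrow> complex) \<Rightarrow> real \<Rightarrow> bool" where
  "delta_exists a b \<Psi> \<Psi>' 0 f = (\<lambda>x. True)"
| "delta_exists a b \<Psi> \<Psi>' (Suc k) f =
     (\<lambda>x. delta_exists a b \<Psi> \<Psi>' k f x \<and>
          (\<forall>\<^sub>F y in at x within {a..b}. delta_exists a b \<Psi> \<Psi>' k f y) \<and>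
          delta_pow a b \<Psi> \<Psi>' k f differentiable (at x within {a..b}))"

definition AC_delta ::
  "real \<Rightarrow> real \<Rightarrow> (real \<Rightarrow> real) \<Rightarrow> (real \<Rightarrow> real) \<Rightarrow> real \<Rightarrow> nat \<Rightarrow> (real \<Rightarrow> complex) set" where
  "AC_delta a b \<Psi> \<Psi>' s n =
     {h. (\<forall>x\<in>{a..b}. delta_exists a b \<Psi> \<Psi>' (n - 1) (\<lambda>x. (\<Psi> x powr s) *\<^sub>R h x) x) \<and>
         abs_continuous_on_interval a b (delta_pow a b \<Psi> \<Psi>' (n - 1) (\<lambda>x. (\<Psi> x powr s) *\<^sub>R h x))}"

definition hadamard_integrand ::
  "real \<Rightarrow> real \<Rightarrow> (real \<Rightarrow> real) \<Rightarrow> (real \<Rightarrow> real) \<Rightarrow> (real \<Rightarrow> complex) \<Rightarrow> real \<Rightarrow> real \<Rightarrow> complex" where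
  "hadamard_integrand \<mu> s \<Psi> \<Psi>' f x t =
     ((\<Psi> t / \<Psi> x) powr s * ln (\<Psi> x / \<Psi> t) powr (\<mu> - 1) * (\<Psi>' t / \<Psi> t)) *\<^sub>R f t"

definition hadamard_integral ::
  "real \<Rightarrow> real \<Rightarrow> real \<Rightarrow> (real \<Rightarrow> real) \<Rightarrow> (real \<Rightarrow> real) \<Rightarrow> (real \<Rightarrow> complex) \<Rightarrow> real \<Rightarrow> complex" where
  "hadamard_integral a \<mu> s \<Psi> \<Psi>' f x =
     (1 / Gamma \<mu>) *\<^sub>R (LINT t:{a..x}|lebesgue. hadamard_integrand \<mu> s \<Psi> \<Psi>' f x t)"

definition hadamard_integral_exists ::
  "real \<Rightarrow> real \<Rightarrow> real \<Rightarrow> (real \<Rightarrow> real) \<Rightarrow> (real \<Rightarrow> real) \<Rightarrow> (real \<Rightarrow> complex) \<Rightarrow> real \<Rightarrow> bool" where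
  "hadamard_integral_exists a \<mu> s \<Psi> \<Psi>' f x \<longleftrightarrow>
     set_integrable lebesgue {a..x} (hadamard_integrand \<mu> s \<Psi> \<Psi>' f x)"

definition hadamard_deriv ::
  "real \<Rightarrow> real \<Rightarrow> real \<Rightarrow> real \<Rightarrow> (real \<Rightarrow> real) \<Rightarrow> (real \<Rightarrow> real) \<Rightarrow> (real \<Rightarrow> complex) \<Rightarrow> real \<Rightarrow> complex" where
  "hadamard_deriv a b \<mu> s \<Psi> \<Psi>' f x =
     (let n = nat \<lfloor>\<mu>\<rfloor> + 1 in
        (\<Psi> x powr (- s)) *\<^sub>R
        delta_pow a b \<Psi> \<Psi>' n
          (\<lambda>y. (\<Psi> y powr s) *\<^sub>R hadamard_integral a (real n - \<mu>) s \<Psi> \<Psi>' f y) x)"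

text \<open>
  Existence at \<open>x\<close> includes convergence of the inner integral at every point of \<open>[a, b]\<close>, so that
  the iterated derivative is applied to a genuine function on \<open>[a, b]\<close>.
\<close>

definition hadamard_deriv_exists ::
  "real \<Rightarrow> real \<Rightarrow> real \<Rightarrow> real \<Rightarrow> (real \<Rightarrow> real) \<Rightarrow> (real \<Rightarrow> real) \<Rightarrow> (real \<Rightarrow> complex) \<Rightarrow> real \<Rightarrow> bool" where
  "hadamard_deriv_exists a b \<mu> s \<Psi> \<Psi>' f x \<longleftrightarrow>
     (let n = nat \<lfloor>\<mu>\<rfloor> + 1 in
        (\<forall>y\<in>{a..b}. hadamard_integral_exists a (real n - \<mu>) s \<Psi> \<Psi>' f y) \<and>
        delta_exists a b \<Psi> \<Psi>' n
          (\<lambda>y. (\<Psi> y powr s) *\<^sub>R hadamard_integral a (real n - \<mu>) s \<Psi> \<Psi>' f y) x)"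

end

theory Submission
  imports Defs
begin

text \<open>
  Put \<open>\<phi> = ln \<circ> \<Psi>\<close> and \<open>\<nu> = n - \<mu> \<in> (0, 1]\<close>. Since \<open>\<phi>' = \<Psi>'/\<Psi>\<close>, the operator \<open>(\<Psi>/\<Psi>') d/dx\<close> is
  differentiation with respect to \<open>\<phi>\<close>, and \<open>\<Psi>\<^sup>s\<close> times the Hadamard-type integral of \<open>g\<close> is the
  Riemann-Liouville integral of order \<open>\<nu>\<close> of \<open>g\<^sub>0 = \<Psi>\<^sup>s g\<close> with respect to \<open>\<phi>\<close>,

    \<open>I f(x) = 1/\<Gamma>(\<nu>) \<integral>\<^sub>a\<^sup>x (\<phi>(x) - \<phi>(t))\<^sup>\<nu>\<^sup>-\<^sup>1 \<phi>'(t) f(t) dt\<close>.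

  Everything rests on one identity. If \<open>f(x) = f(a) + \<integral>\<^sub>a\<^sup>x p(t) dt\<close> with \<open>p\<close> integrable, then

    \<open>I f(x) = (\<phi>(x) - \<phi>(a))\<^sup>\<nu> f(a) / \<Gamma>(\<nu> + 1) + \<integral>\<^sub>a\<^sup>x \<phi>'(w) J p(w) dw\<close>

  with \<open>J p(w) = 1/\<Gamma>(\<nu>) \<integral>\<^sub>a\<^sup>w (\<phi>(w) - \<phi>(t))\<^sup>\<nu>\<^sup>-\<^sup>1 p(t) dt\<close>, because both double integrals that occur here
  reduce by Fubini to the same single integral (\<open>fractional_integral_by_parts\<close>). The identity shows at
  once that \<open>I f\<close> is continuous. Differentiating it with respect to \<open>\<phi>\<close> gives
  \<open>(\<phi> - \<phi>(a))\<^sup>\<nu>\<^sup>-\<^sup>1 f(a) / \<Gamma>(\<nu>) + J p\<close>: at every point of \<open>(a, b]\<close> if \<open>p = \<phi>' q\<close> with \<open>q\<close> itself an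
  indefinite integral, as then \<open>J p = I q\<close> is continuous; almost everywhere in general, by Lebesgue's
  differentiation theorem. Applying the first version \<open>n - 1\<close> times, starting from \<open>f = g\<^sub>0\<close>, and the
  second one once to \<open>g\<^sub>n\<^sub>-\<^sub>1\<close>, produces the formula. The power terms are differentiated along the
  way by \<open>z / \<Gamma>(z + 1) = 1 / \<Gamma>(z)\<close>, which remains true at the poles of \<open>\<Gamma>\<close>.

  The second ingredient is Lebesgue's theorem that the absolutely continuous function \<open>g\<^sub>n\<^sub>-\<^sub>1\<close>
  is the indefinite integral of its derivative. It suffices to find some integrable density
  (\<open>abs_continuous_density\<close>), as this is then the derivative almost everywhere. With \<open>V\<close> its total
  variation, \<open>V\<close> and \<open>V\<close> minus the real or imaginary part are increasing and absolutely continuous, so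
  their Stieltjes measures are absolutely continuous with respect to Lebesgue measure
  (\<open>stieltjes_measure_null\<close>) and have Radon-Nikodym densities.
\<close>

section \<open>Absolutely continuous functions on an interval\<close>

text \<open>
  The families of non-overlapping subintervals of \<open>[c, d]\<close> over which absolute continuity is tested.
\<close>

definition interval_family :: "real \<Rightarrow> real \<Rightarrow> (real \<times> real) set \<Rightarrow> bool" where
  "interval_family c d I \<longleftrightarrow> finite I \<and> (\<forall>(u, v)\<in>I. c \<le> u \<and> u \<le> v \<and> v \<le> d) \<and>
     disjoint_family_on (\<lambda>(u, v). {u<..<v}) I"

lemma interval_family_empty [simp]: "interval_family c d {}"
  by (simp add: interval_family_def disjoint_family_on_def)

lemma interval_family_mono:
  "interval_family c d I \<Longrightarrow> c' \<le> c \<Longrightarrow> d \<le> d' \<Longrightarrow> interval_family c' d' I"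
  unfolding interval_family_def by force

text \<open>
  Clipping and nesting of families yield intervals with a natural index, possibly degenerate and
  with repetitions among the degenerate ones. Passing to the set of pairs loses only those, and they
  do not contribute to sums of functions that vanish on them.
\<close>

lemma interval_family_image:
  fixes u v :: "'i \<Rightarrow> real"
  assumes "finite K" and bounds: "\<And>k. k \<in> K \<Longrightarrow> c \<le> u k \<and> u k \<le> v k \<and> v k \<le> d"
    and disj: "disjoint_family_on (\<lambda>k. {u k<..<v k}) K"
  shows "interval_family c d ((\<lambda>k. (u k, v k)) ` K)"
    and "(\<And>x. h (x, x) = 0) \<Longrightarrow>
      sum h ((\<lambda>k. (u k, v k)) ` K) = (\<Sum>k\<in>K. h (u k, v k) :: 'b::comm_monoid_add)"
proof -
  show "interval_family c d ((\<lambda>k. (u k, v k)) ` K)"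
    unfolding interval_family_def
  proof (intro conjI)
    show "disjoint_family_on (\<lambda>(u, v). {u<..<v}) ((\<lambda>k. (u k, v k)) ` K)"
      unfolding disjoint_family_on_def
    proof (intro ballI impI)
      fix p q assume "p \<in> (\<lambda>k. (u k, v k)) ` K" "q \<in> (\<lambda>k. (u k, v k)) ` K" "p \<noteq> q"
      then obtain k l where "k \<in> K" "l \<in> K" "k \<noteq> l" "p = (u k, v k)" "q = (u l, v l)" by blast
      then show "(case p of (u, v) \<Rightarrow> {u<..<v}) \<inter> (case q of (u, v) \<Rightarrow> {u<..<v}) = {}"
        using disj unfolding disjoint_family_on_def by simp
    qed
  qed (use assms in auto)
  assume h: "\<And>x. h (x, x) = 0"
  show "sum h ((\<lambda>k. (u k, v k)) ` K) = (\<Sum>k\<in>K. h (u k, v k))"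
  proof (subst sum.reindex_nontrivial)
    fix k l assume kl: "k \<in> K" "l \<in> K" "k \<noteq> l" "(u k, v k) = (u l, v l)"
    then have "{u k<..<v k} = {}"
      using disj unfolding disjoint_family_on_def by force
    then have "u k = v k" using bounds[OF kl(1)] by force
    then show "h (u k, v k) = 0" using h by simp
  qed (use assms in simp_all)
qed

lemma interval_family_length_le_emeasure:
  assumes "interval_family c d I" "\<And>u v. (u, v) \<in> I \<Longrightarrow> {u<..<v} \<subseteq> S" "S \<in> sets lebesgue"
  shows "ennreal (\<Sum>(u, v)\<in>I. v - u) \<le> emeasure lebesgue S"
proof -
  have I: "finite I" "\<And>u v. (u, v) \<in> I \<Longrightarrow> u \<le> v" "disjoint_family_on (\<lambda>(u, v). {u<..<v}) I"
    using assms(1) unfolding interval_family_def by auto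
  have "ennreal (\<Sum>(u, v)\<in>I. v - u) = (\<Sum>p\<in>I. ennreal (case p of (u, v) \<Rightarrow> v - u))"
    by (subst sum_ennreal) (use I(2) in auto)
  also have "\<dots> = (\<Sum>p\<in>I. emeasure lebesgue (case p of (u, v) \<Rightarrow> {u<..<v}))"
    using I(2) by (intro sum.cong refl) auto
  also have "\<dots> = emeasure lebesgue (\<Union>p\<in>I. case p of (u, v) \<Rightarrow> {u<..<v})"
    by (rule sum_emeasure) (use I in auto)
  also have "\<dots> \<le> emeasure lebesgue S"
    using assms by (intro emeasure_mono) auto
  finally show ?thesis .
qed

lemma interval_family_length_le:
  assumes "interval_family c d I" "c \<le> d"
  shows "(\<Sum>(u, v)\<in>I. v - u) \<le> d - c"
proof -
  have "{u<..<v} \<subseteq> {c..d}" if "(u, v) \<in> I" for u v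
    using assms that unfolding interval_family_def by fastforce
  then have "ennreal (\<Sum>(u, v)\<in>I. v - u) \<le> emeasure lebesgue {c..d}"
    using assms by (intro interval_family_length_le_emeasure) auto
  then show ?thesis using \<open>c \<le> d\<close> by simp
qed

lemma abs_continuous_onD:
  assumes "abs_continuous_on_interval a b f" "\<epsilon> > 0"
  obtains \<delta> where "\<delta> > 0" "\<And>I. interval_family a b I \<Longrightarrow> (\<Sum>(c, d)\<in>I. d - c) < \<delta> \<Longrightarrow>
    (\<Sum>(c, d)\<in>I. norm (f d - f c)) < \<epsilon>"
  using assms unfolding abs_continuous_on_interval_def interval_family_def by meson

lemma abs_continuous_onI:
  assumes "\<And>\<epsilon>. \<epsilon> > 0 \<Longrightarrow> \<exists>\<delta>>0. \<forall>I. interval_family a b I \<longrightarrow> (\<Sum>(c, d)\<in>I. d - c) < \<delta> \<longrightarrow>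
    (\<Sum>(c, d)\<in>I. norm (f d - f c)) < \<epsilon>"
  shows "abs_continuous_on_interval a b f"
  unfolding abs_continuous_on_interval_def
proof (intro allI impI)
  fix \<epsilon> :: real assume "\<epsilon> > 0"
  from assms[OF this] obtain \<delta> where "\<delta> > 0" "\<forall>I. interval_family a b I \<longrightarrow> (\<Sum>(c, d)\<in>I. d - c) < \<delta> \<longrightarrow>
    (\<Sum>(c, d)\<in>I. norm (f d - f c)) < \<epsilon>" by blast
  then show "\<exists>\<delta>>0. \<forall>I :: (real \<times> real) set.
        finite I \<and> (\<forall>(c, d) \<in> I. a \<le> c \<and> c \<le> d \<and> d \<le> b) \<and>
        disjoint_family_on (\<lambda>(c, d). {c<..<d}) I \<and> (\<Sum>(c, d)\<in>I. d - c) < \<delta>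
        \<longrightarrow> (\<Sum>(c, d)\<in>I. norm (f d - f c)) < \<epsilon>"
    unfolding interval_family_def by (intro exI[of _ \<delta>]) simp
qed

lemma abs_continuous_on_imp_continuous_on:
  assumes "abs_continuous_on_interval a b f"
  shows "continuous_on {a..b} f"
  unfolding continuous_on_iff
proof (intro ballI allI impI)
  fix x \<epsilon> :: real assume "x \<in> {a..b}" "\<epsilon> > 0"
  obtain \<delta> where "\<delta> > 0" and \<delta>: "\<And>I. interval_family a b I \<Longrightarrow> (\<Sum>(c, d)\<in>I. d - c) < \<delta> \<Longrightarrow>
    (\<Sum>(c, d)\<in>I. norm (f d - f c)) < \<epsilon>"
    using abs_continuous_onD[OF assms \<open>\<epsilon> > 0\<close>] by blast
  have "dist (f y) (f x) < \<epsilon>" if "y \<in> {a..b}" "dist y x < \<delta>" for y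
  proof (cases "x \<le> y")
    case True
    then show ?thesis
      using \<delta>[of "{(x, y)}"] that \<open>x \<in> {a..b}\<close>
      by (auto simp: interval_family_def disjoint_family_on_def dist_norm)
  next
    case False
    then show ?thesis
      using \<delta>[of "{(y, x)}"] that \<open>x \<in> {a..b}\<close>
      by (auto simp: interval_family_def disjoint_family_on_def dist_norm norm_minus_commute)
  qed
  then show "\<exists>d>0. \<forall>x'\<in>{a..b}. dist x' x < d \<longrightarrow> dist (f x') (f x) < \<epsilon>"
    using \<open>\<delta> > 0\<close> by blast
qed

lemma abs_continuous_on_diff:
  assumes f: "abs_continuous_on_interval a b f" and g: "abs_continuous_on_interval a b g"
  shows "abs_continuous_on_interval a b (\<lambda>x. f x - g x)"
proof (rule abs_continuous_onI)
  fix \<epsilon> :: real assume "\<epsilon> > 0"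
  then have "\<epsilon> / 2 > 0" by simp
  obtain \<delta>1 where 1: "\<delta>1 > 0" "\<And>I. interval_family a b I \<Longrightarrow> (\<Sum>(c, d)\<in>I. d - c) < \<delta>1 \<Longrightarrow>
    (\<Sum>(c, d)\<in>I. norm (f d - f c)) < \<epsilon> / 2"
    using abs_continuous_onD[OF f \<open>\<epsilon> / 2 > 0\<close>] by blast
  obtain \<delta>2 where 2: "\<delta>2 > 0" "\<And>I. interval_family a b I \<Longrightarrow> (\<Sum>(c, d)\<in>I. d - c) < \<delta>2 \<Longrightarrow>
    (\<Sum>(c, d)\<in>I. norm (g d - g c)) < \<epsilon> / 2"
    using abs_continuous_onD[OF g \<open>\<epsilon> / 2 > 0\<close>] by blast
  have "(\<Sum>(c, d)\<in>I. norm ((f d - g d) - (f c - g c))) < \<epsilon>"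
    if I: "interval_family a b I" "(\<Sum>(c, d)\<in>I. d - c) < min \<delta>1 \<delta>2" for I
  proof -
    have "norm ((f d - g d) - (f c - g c)) \<le> norm (f d - f c) + norm (g d - g c)" for c d
      using norm_triangle_ineq4[of "f d - f c" "g d - g c"] by (simp add: algebra_simps)
    then have "(\<Sum>(c, d)\<in>I. norm ((f d - g d) - (f c - g c))) \<le>
        (\<Sum>(c, d)\<in>I. norm (f d - f c) + norm (g d - g c))"
      by (intro sum_mono) auto
    also have "\<dots> = (\<Sum>(c, d)\<in>I. norm (f d - f c)) + (\<Sum>(c, d)\<in>I. norm (g d - g c))"
      by (simp add: case_prod_unfold sum.distrib)
    also have "\<dots> < \<epsilon>" using 1(2)[OF I(1)] 2(2)[OF I(1)] I(2) by simp
    finally show ?thesis .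
  qed
  then show "\<exists>\<delta>>0. \<forall>I. interval_family a b I \<longrightarrow> (\<Sum>(c, d)\<in>I. d - c) < \<delta> \<longrightarrow>
    (\<Sum>(c, d)\<in>I. norm ((f d - g d) - (f c - g c))) < \<epsilon>"
    using 1(1) 2(1) by (intro exI[of _ "min \<delta>1 \<delta>2"]) auto
qed

lemma abs_continuous_on_dominated:
  assumes f: "abs_continuous_on_interval a b f"
    and le: "\<And>c d. norm (g d - g c) \<le> norm (f d - f c)"
  shows "abs_continuous_on_interval a b g"
proof (rule abs_continuous_onI)
  fix \<epsilon> :: real assume "\<epsilon> > 0"
  obtain \<delta> where 1: "\<delta> > 0" "\<And>I. interval_family a b I \<Longrightarrow> (\<Sum>(c, d)\<in>I. d - c) < \<delta> \<Longrightarrow>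
    (\<Sum>(c, d)\<in>I. norm (f d - f c)) < \<epsilon>"
    using abs_continuous_onD[OF f \<open>\<epsilon> > 0\<close>] by blast
  have "(\<Sum>(c, d)\<in>I. norm (g d - g c)) \<le> (\<Sum>(c, d)\<in>I. norm (f d - f c))" for I
    using le by (intro sum_mono) auto
  then show "\<exists>\<delta>>0. \<forall>I. interval_family a b I \<longrightarrow> (\<Sum>(c, d)\<in>I. d - c) < \<delta> \<longrightarrow>
    (\<Sum>(c, d)\<in>I. norm (g d - g c)) < \<epsilon>"
    using 1 by (intro exI[of _ \<delta>]) (auto intro: le_less_trans)
qed

section \<open>Total variation\<close>

definition variation_sum :: "(real \<Rightarrow> 'a::real_normed_vector) \<Rightarrow> (real \<times> real) set \<Rightarrow> real" where
  "variation_sum f I = (\<Sum>(u, v)\<in>I. norm (f v - f u))"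

text \<open>
  A supremum in the reals: it is the total variation only where the sums are bounded, which absolute
  continuity ensures.
\<close>

definition variation :: "(real \<Rightarrow> 'a::real_normed_vector) \<Rightarrow> real \<Rightarrow> real \<Rightarrow> real" where
  "variation f c d = (SUP I\<in>{I. interval_family c d I}. variation_sum f I)"

text \<open>
  Clip every interval at \<open>m\<close> from above and from below. An interval that does not contain \<open>m\<close>
  degenerates on one side; for one that does, the triangle inequality through \<open>f m\<close> applies.
\<close>

lemma interval_family_split:
  assumes "interval_family c e I" "c \<le> m" "m \<le> e"
  obtains I1 I2 where "interval_family c m I1" "interval_family m e I2"
    "variation_sum f I \<le> variation_sum f I1 + variation_sum f I2"
proof -
  define u1 v1 u2 v2 where "u1 p = min (fst p) m" and "v1 p = min (snd p) m"
    and "u2 p = max (fst p) m" and "v2 p = max (snd p) m" for p :: "real \<times> real"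
  note defs = this
  have I: "finite I" "\<And>p. p \<in> I \<Longrightarrow> c \<le> fst p \<and> fst p \<le> snd p \<and> snd p \<le> e"
    and disj: "disjoint_family_on (\<lambda>p. {fst p<..<snd p}) I"
    using assms(1) unfolding interval_family_def by (auto simp: case_prod_unfold)
  have disj1: "disjoint_family_on (\<lambda>p. {u1 p<..<v1 p}) I" "disjoint_family_on (\<lambda>p. {u2 p<..<v2 p}) I"
    by (rule disjoint_family_on_bisimulation[OF disj], use I(2) in \<open>force simp: defs\<close>)+
  let ?I1 = "(\<lambda>p. (u1 p, v1 p)) ` I" and ?I2 = "(\<lambda>p. (u2 p, v2 p)) ` I"
  have b1: "c \<le> u1 p \<and> u1 p \<le> v1 p \<and> v1 p \<le> m" and b2: "m \<le> u2 p \<and> u2 p \<le> v2 p \<and> v2 p \<le> e"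
    if "p \<in> I" for p
    using I(2)[OF that] assms(2,3) by (auto simp: defs)
  have "norm (f (snd p) - f (fst p)) \<le> norm (f (v1 p) - f (u1 p)) + norm (f (v2 p) - f (u2 p))"
    if "p \<in> I" for p
  proof (cases "fst p \<le> m \<and> m \<le> snd p")
    case True
    then have "v1 p = m" "u2 p = m" "u1 p = fst p" "v2 p = snd p" by (auto simp: defs)
    then show ?thesis
      using norm_triangle_ineq[of "f m - f (fst p)" "f (snd p) - f m"] by simp
  next
    case False
    then show ?thesis using I(2)[OF that] by (auto simp: defs min_def max_def)
  qed
  then have "variation_sum f I \<le>
      (\<Sum>p\<in>I. norm (f (v1 p) - f (u1 p)) + norm (f (v2 p) - f (u2 p)))"
    unfolding variation_sum_def case_prod_unfold by (intro sum_mono)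
  also have "\<dots> = variation_sum f ?I1 + variation_sum f ?I2"
    unfolding variation_sum_def sum.distrib
    by (intro arg_cong2[where f="(+)"];
        subst interval_family_image(2)[OF I(1) b1 disj1(1)] interval_family_image(2)[OF I(1) b2 disj1(2)]; simp)
  finally show ?thesis
    using that interval_family_image(1)[OF I(1) b1 disj1(1)] interval_family_image(1)[OF I(1) b2 disj1(2)]
    by blast
qed
text \<open>
  On an interval shorter than the \<open>\<delta>\<close> belonging to \<open>\<epsilon> = 1\<close> every variation sum is less than 1, and
  boundedness on two adjacent intervals gives boundedness on their union by splitting.
\<close>

lemma bdd_above_variation_sums:
  assumes ac: "abs_continuous_on_interval a b f" and "a \<le> b"
  shows "bdd_above (variation_sum f ` {I. interval_family a b I})"
proof -
  obtain \<delta> where \<delta>: "\<delta> > 0" "\<And>I. interval_family a b I \<Longrightarrow> (\<Sum>(c, d)\<in>I. d - c) < \<delta> \<Longrightarrow>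
    (\<Sum>(c, d)\<in>I. norm (f d - f c)) < 1"
    using abs_continuous_onD[OF ac zero_less_one] by blast
  define P where "P c d \<longleftrightarrow> (a \<le> c \<and> d \<le> b \<longrightarrow>
    bdd_above (variation_sum f ` {I. interval_family c d I}))" for c d
  have "P a b" using \<open>a \<le> b\<close>
  proof (induction rule: Bolzano)
    case (trans c m e)
    show ?case unfolding P_def
    proof
      assume "a \<le> c \<and> e \<le> b"
      with trans obtain B1 B2 where B: "\<And>I. interval_family c m I \<Longrightarrow> variation_sum f I \<le> B1"
        "\<And>I. interval_family m e I \<Longrightarrow> variation_sum f I \<le> B2"
        unfolding P_def bdd_above_def by auto
      have "variation_sum f I \<le> B1 + B2" if "interval_family c e I" for I
        using interval_family_split[OF that trans(3,4)] B by (smt (verit))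
      then show "bdd_above (variation_sum f ` {I. interval_family c e I})"
        unfolding bdd_above_def by auto
    qed
  next
    case (local x)
    have "P c d" if cd: "c \<le> x" "x \<le> d" "d - c < \<delta>" for c d
      unfolding P_def
    proof
      assume ab: "a \<le> c \<and> d \<le> b"
      have "variation_sum f I \<le> 1" if I: "interval_family c d I" for I
      proof -
        have "(\<Sum>(u, v)\<in>I. v - u) < \<delta>"
          using interval_family_length_le[OF I] cd by simp
        then show ?thesis
          using \<delta>(2)[OF interval_family_mono[OF I]] ab unfolding variation_sum_def by fastforce
      qed
      then show "bdd_above (variation_sum f ` {I. interval_family c d I})"
        unfolding bdd_above_def by auto
    qed
    then show ?case using \<delta>(1) by blast
  qed
  then show ?thesis unfolding P_def by simp
qed

context
  fixes a b :: real and f :: "real \<Rightarrow> 'a::real_normed_vector"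
  assumes ab: "a \<le> b" and ac: "abs_continuous_on_interval a b f"
begin

lemma variation_sum_le_variation:
  assumes "interval_family c d I" "a \<le> c" "d \<le> b"
  shows "variation_sum f I \<le> variation f c d"
  unfolding variation_def
proof (rule cSUP_upper)
  show "bdd_above (variation_sum f ` {I. interval_family c d I})"
    by (rule bdd_above_mono[OF bdd_above_variation_sums[OF ac ab]])
       (use interval_family_mono assms(2,3) in blast)
qed (use assms in simp)

lemma variation_approx:
  assumes "\<eta> > 0" "a \<le> c" "d \<le> b"
  obtains I where "interval_family c d I" "variation f c d < variation_sum f I + \<eta>"
proof -
  have "\<exists>z\<in>variation_sum f ` {I. interval_family c d I}. variation f c d - \<eta> < z"
    unfolding variation_def
    by (rule less_cSupD) (use assms interval_family_empty in \<open>auto intro: exI[of _ "{}"]\<close>)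
  then show ?thesis using that by force
qed

lemma variation_split_le:
  assumes "a \<le> c" "c \<le> m" "m \<le> e" "e \<le> b"
  shows "variation f c e \<le> variation f c m + variation f m e"
  unfolding variation_def[of f c e]
proof (rule cSUP_least)
  fix I assume "I \<in> {I. interval_family c e I}"
  then obtain I1 I2 where "interval_family c m I1" "interval_family m e I2"
    "variation_sum f I \<le> variation_sum f I1 + variation_sum f I2"
    using interval_family_split assms(2,3) by blast
  moreover have "variation_sum f I1 \<le> variation f c m" "variation_sum f I2 \<le> variation f m e"
    using variation_sum_le_variation calculation assms by auto
  ultimately show "variation_sum f I \<le> variation f c m + variation f m e" by linarith
qed (use interval_family_empty in blast)

text \<open>
  Adding \<open>[x, y]\<close> to a family in \<open>[a, x]\<close> gives a family in \<open>[a, y]\<close>. This makes the variation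
  increase at least as fast as every real function dominated by the increments of \<open>f\<close>.
\<close>

lemma norm_diff_le_variation_diff:
  assumes "a \<le> x" "x \<le> y" "y \<le> b"
  shows "norm (f y - f x) \<le> variation f a y - variation f a x"
proof -
  have "variation f a x \<le> variation f a y - norm (f y - f x)"
    unfolding variation_def[of f a x]
  proof (rule cSUP_least)
    fix I assume "I \<in> {I. interval_family a x I}"
    then have I: "interval_family a x I" by simp
    have disj: "disjoint_family_on (\<lambda>(u, v). {u<..<v}) (insert (x, y) I)"
      using I unfolding interval_family_def disjoint_family_on_def by fastforce
    have fam: "interval_family a y (insert (x, y) I)"
      using I disj assms unfolding interval_family_def by force
    have "variation_sum f I + norm (f y - f x) \<le> variation_sum f (insert (x, y) I)"
    proof (cases "(x, y) \<in> I")
      case True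
      then have "y = x" using I assms unfolding interval_family_def by force
      then show ?thesis using True by (simp add: insert_absorb)
    next
      case False
      then show ?thesis using I unfolding interval_family_def variation_sum_def by simp
    qed
    then show "variation_sum f I \<le> variation f a y - norm (f y - f x)"
      using variation_sum_le_variation[OF fam] assms by simp
  qed (use interval_family_empty in blast)
  then show ?thesis by simp
qed

text \<open>
  Inside each interval of a short family choose a subfamily that nearly attains the variation there.
  Together these subfamilies form a family that is no longer than the given one, so absolute
  continuity of \<open>f\<close> bounds the sum of the variations.
\<close>

lemma abs_continuous_on_variation:
  "abs_continuous_on_interval a b (\<lambda>x. variation f a x)"
proof (rule abs_continuous_onI)
  fix \<epsilon> :: real assume "\<epsilon> > 0"
  then have "\<epsilon> / 2 > 0" by simp
  obtain \<delta> where \<delta>: "\<delta> > 0" "\<And>I. interval_family a b I \<Longrightarrow> (\<Sum>(c, d)\<in>I. d - c) < \<delta> \<Longrightarrow>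
    variation_sum f I < \<epsilon> / 2"
    using abs_continuous_onD[OF ac \<open>\<epsilon> / 2 > 0\<close>] unfolding variation_sum_def by blast
  have "(\<Sum>(c, d)\<in>I. norm (variation f a d - variation f a c)) < \<epsilon>"
    if I: "interval_family a b I" and len: "(\<Sum>(c, d)\<in>I. d - c) < \<delta>" for I
  proof -
    have fin: "finite I" and bd: "\<And>p. p \<in> I \<Longrightarrow> a \<le> fst p \<and> fst p \<le> snd p \<and> snd p \<le> b"
      and disj: "disjoint_family_on (\<lambda>p. {fst p<..<snd p}) I"
      using I unfolding interval_family_def by (auto simp: case_prod_unfold)
    \<comment> \<open>A slack of \<open>\<eta>\<close> for each interval adds up to at most \<open>\<epsilon> / 2\<close>.\<close>
    define \<eta> where "\<eta> = \<epsilon> / 2 / (real (card I) + 1)"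
    have "\<eta> > 0" using \<open>\<epsilon> > 0\<close> by (simp add: \<eta>_def)
    have "\<exists>J. interval_family (fst p) (snd p) J \<and> variation f (fst p) (snd p) < variation_sum f J + \<eta>"
      if "p \<in> I" for p
      using variation_approx[OF \<open>\<eta> > 0\<close>, of "fst p" "snd p"] bd[OF that] by metis
    then obtain J where J: "\<And>p. p \<in> I \<Longrightarrow> interval_family (fst p) (snd p) (J p)"
      "\<And>p. p \<in> I \<Longrightarrow> variation f (fst p) (snd p) < variation_sum f (J p) + \<eta>"
      by metis
    \<comment> \<open>Indexed by pairs, as the chosen families may share degenerate intervals.\<close>
    let ?K = "SIGMA p:I. J p"
    have finJ: "finite (J p)" if "p \<in> I" for p using J(1)[OF that] unfolding interval_family_def by simp
    have K1: "finite ?K" using fin finJ by auto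
    have K2: "a \<le> fst (snd k) \<and> fst (snd k) \<le> snd (snd k) \<and> snd (snd k) \<le> b" if "k \<in> ?K" for k
      using that J(1) bd unfolding interval_family_def by (fastforce simp: case_prod_unfold)
    have K3: "disjoint_family_on (\<lambda>k. {fst (snd k)<..<snd (snd k)}) ?K"
      unfolding disjoint_family_on_def
    proof (intro ballI impI)
      fix k l assume kl: "k \<in> ?K" "l \<in> ?K" "k \<noteq> l"
      show "{fst (snd k)<..<snd (snd k)} \<inter> {fst (snd l)<..<snd (snd l)} = {}"
      proof (cases "fst k = fst l")
        case True
        then have "snd k \<noteq> snd l" "snd k \<in> J (fst k)" "snd l \<in> J (fst k)" "fst k \<in> I"
          using kl by (auto simp: prod_eq_iff)
        then show ?thesis
          using J(1) unfolding interval_family_def disjoint_family_on_def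
          by (fastforce simp: case_prod_unfold)
      next
        case False
        have sub: "{fst (snd k)<..<snd (snd k)} \<subseteq> {fst (fst k)<..<snd (fst k)}" if "k \<in> ?K" for k
          using that J(1) unfolding interval_family_def by (fastforce simp: case_prod_unfold)
        have "{fst (fst k)<..<snd (fst k)} \<inter> {fst (fst l)<..<snd (fst l)} = {}"
          using disj False kl unfolding disjoint_family_on_def by force
        then show ?thesis using sub[OF kl(1)] sub[OF kl(2)] by blast
      qed
    qed
    let ?I' = "(\<lambda>k. (fst (snd k), snd (snd k))) ` ?K"
    have fam: "interval_family a b ?I'"
      by (rule interval_family_image(1)[OF K1 K2 K3])
    have "(\<Sum>(u, v)\<in>?I'. v - u) = (\<Sum>k\<in>?K. snd (snd k) - fst (snd k))"
      by (subst interval_family_image(2)[OF K1 K2 K3]) (auto simp: case_prod_unfold)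
    also have "\<dots> = (\<Sum>p\<in>I. \<Sum>q\<in>J p. snd q - fst q)"
      by (subst sum.Sigma) (use fin finJ in \<open>auto simp: case_prod_unfold\<close>)
    also have "\<dots> \<le> (\<Sum>p\<in>I. snd p - fst p)"
      using interval_family_length_le[OF J(1)] bd by (intro sum_mono) (simp add: case_prod_unfold)
    also have "\<dots> < \<delta>" using len by (simp add: case_prod_unfold)
    finally have small: "variation_sum f ?I' < \<epsilon> / 2" by (rule \<delta>(2)[OF fam])
    have eq0: "variation_sum f ?I' = (\<Sum>k\<in>?K. norm (f (snd (snd k)) - f (fst (snd k))))"
      unfolding variation_sum_def
      by (subst interval_family_image(2)[OF K1 K2 K3]) (auto simp: case_prod_unfold)
    have eq1: "(\<Sum>k\<in>?K. norm (f (snd (snd k)) - f (fst (snd k)))) = (\<Sum>p\<in>I. variation_sum f (J p))"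
      unfolding variation_sum_def
      by (subst sum.Sigma) (use fin finJ in \<open>auto simp: case_prod_unfold\<close>)
    from eq0 eq1 have eq: "variation_sum f ?I' = (\<Sum>p\<in>I. variation_sum f (J p))" by (rule trans)
    have "(\<Sum>(c, d)\<in>I. norm (variation f a d - variation f a c)) \<le>
        (\<Sum>p\<in>I. variation_sum f (J p) + \<eta>)"
    proof (rule sum_mono)
      fix p assume "p \<in> I"
      note bd = bd[OF this] and J = J(2)[OF this]
      have "variation f a (snd p) \<le> variation f a (fst p) + variation f (fst p) (snd p)"
        using bd by (intro variation_split_le) auto
      moreover have "variation f a (fst p) \<le> variation f a (snd p)"
        using norm_diff_le_variation_diff[of "fst p" "snd p"] bd norm_ge_zero[of "f (snd p) - f (fst p)"]
        by linarith
      ultimately show "(case p of (c, d) \<Rightarrow> norm (variation f a d - variation f a c)) \<le>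
          variation_sum f (J p) + \<eta>"
        using J by (auto simp: case_prod_unfold)
    qed
    also have "\<dots> = variation_sum f ?I' + real (card I) * \<eta>"
      by (simp only: eq sum.distrib sum_constant)
    also have "real (card I) * \<eta> \<le> \<epsilon> / 2"
      using \<open>\<epsilon> > 0\<close> by (simp add: \<eta>_def field_simps)
    finally show ?thesis using small by linarith
  qed
  then show "\<exists>\<delta>>0. \<forall>I. interval_family a b I \<longrightarrow> (\<Sum>(c, d)\<in>I. d - c) < \<delta> \<longrightarrow>
    (\<Sum>(c, d)\<in>I. norm (variation f a d - variation f a c)) < \<epsilon>"
    using \<delta>(1) by blast
qed

end

section \<open>Absolutely continuous functions are indefinite integrals\<close>

lemma integrable_imp_set_integrable:
  fixes p :: "'a \<Rightarrow> 'b::{banach, second_countable_topology}"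
  shows "integrable M p \<Longrightarrow> S \<in> sets M \<Longrightarrow> set_integrable M S p"
  unfolding set_integrable_def by (intro integrable_mult_indicator)

text \<open>
  A null set is covered by countably many non-overlapping intervals of small total length. Their
  Stieltjes measure is the sum of the increments of \<open>F\<close>, hence small by absolute continuity, first
  for finite subfamilies and then in the limit. \<open>G\<close> is an extension of \<open>F\<close> to the line, since
  Stieltjes measures are defined by functions on the whole line.
\<close>

lemma stieltjes_measure_null:
  fixes F G :: "real \<Rightarrow> real"
  assumes mono: "\<And>x y. a \<le> x \<Longrightarrow> x \<le> y \<Longrightarrow> y \<le> b \<Longrightarrow> F x \<le> F y"
    and ac: "abs_continuous_on_interval a b F"
    and G: "\<And>x y. x \<le> y \<Longrightarrow> G x \<le> G y" "continuous_on UNIV G" "\<And>x. x \<in> {a..b} \<Longrightarrow> G x = F x"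
    and N: "N \<in> null_sets lborel" "N \<subseteq> {a..b}"
  shows "emeasure (interval_measure G) N = 0"
proof -
  let ?M = "interval_measure G"
  have "emeasure ?M N \<le> ennreal \<epsilon>" if "\<epsilon> > 0" for \<epsilon>
  proof -
    obtain \<delta> where \<delta>: "\<delta> > 0" "\<And>I. interval_family a b I \<Longrightarrow> (\<Sum>(c, d)\<in>I. d - c) < \<delta> \<Longrightarrow>
      (\<Sum>(c, d)\<in>I. norm (F d - F c)) < \<epsilon>"
      using abs_continuous_onD[OF ac \<open>\<epsilon> > 0\<close>] by blast
    \<comment> \<open>Cover of length \<open>\<delta> / 2\<close>, as the length has to stay strictly below \<open>\<delta>\<close>.\<close>
    have null: "N \<in> null_sets lebesgue" using N(1) by (simp add: null_sets_completionI)
    then have "N \<in> lmeasurable" "measure lebesgue N = 0"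
      by (auto simp: fmeasurable_def null_sets_def measure_def)
    obtain D where D: "countable D" "\<And>K. K \<in> D \<Longrightarrow> K \<subseteq> cbox a b \<and> K \<noteq> {} \<and> (\<exists>c d. K = cbox c d)"
        "pairwise (\<lambda>A B. interior A \<inter> interior B = {}) D"
        "N \<subseteq> \<Union>D" "\<Union>D \<in> lmeasurable" "measure lebesgue (\<Union>D) \<le> \<delta> / 2"
    proof (rule measurable_outer_intervals_bounded[of N a b "\<delta> / 2"])
      show "N \<in> lmeasurable" "N \<subseteq> cbox a b" "\<delta> / 2 > 0"
        using \<open>N \<in> lmeasurable\<close> N(2) \<delta>(1) by simp_all
    qed (use \<open>measure lebesgue N = 0\<close> in simp)
    have emD: "emeasure lebesgue (\<Union>D) < ennreal \<delta>"
      using D(5,6) \<delta>(1) by (subst emeasure_eq_measure2) (auto intro!: ennreal_lessI)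
    have Kform: "K = {Inf K..Sup K} \<and> a \<le> Inf K \<and> Inf K \<le> Sup K \<and> Sup K \<le> b" if K: "K \<in> D" for K
    proof -
      obtain c d where "K = {c..d}" "c \<le> d" using D(2)[OF K] by (auto simp: cbox_interval)
      moreover have "{c..d} \<subseteq> {a..b}" using D(2)[OF K] calculation by (simp add: cbox_interval)
      ultimately show ?thesis by auto
    qed
    have fin: "(\<Sum>K\<in>C. emeasure ?M K) \<le> ennreal \<epsilon>" if C: "C \<subseteq> D" "finite C" for C
    proof -
      have disj: "disjoint_family_on (\<lambda>K. {Inf K<..<Sup K}) C"
        unfolding disjoint_family_on_def
      proof (intro ballI impI)
        fix K L assume "K \<in> C" "L \<in> C" "K \<noteq> L"
        then have "interior K \<inter> interior L = {}" using D(3) C(1) unfolding pairwise_def by blast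
        moreover have "interior K = {Inf K<..<Sup K}" "interior L = {Inf L<..<Sup L}"
          using Kform \<open>K \<in> C\<close> \<open>L \<in> C\<close> C(1) interior_atLeastAtMost_real by (metis subsetD)+
        ultimately show "{Inf K<..<Sup K} \<inter> {Inf L<..<Sup L} = {}" by simp
      qed
      have bd: "a \<le> Inf K \<and> Inf K \<le> Sup K \<and> Sup K \<le> b" if "K \<in> C" for K
        using Kform C(1) that by blast
      let ?I = "(\<lambda>K. (Inf K, Sup K)) ` C"
      have fam: "interval_family a b ?I"
        by (rule interval_family_image(1)[OF C(2) bd disj])
      have "ennreal (\<Sum>(u, v)\<in>?I. v - u) \<le> emeasure lebesgue (\<Union>D)"
      proof (rule interval_family_length_le_emeasure[OF fam])
        fix u v assume "(u, v) \<in> ?I"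
        then obtain K where "K \<in> C" "u = Inf K" "v = Sup K" by auto
        then show "{u<..<v} \<subseteq> \<Union>D" using Kform C(1) by fastforce
      qed (use D(5) in auto)
      then have "ennreal (\<Sum>(u, v)\<in>?I. v - u) < ennreal \<delta>" using emD by (rule le_less_trans)
      moreover have "(\<Sum>(u, v)\<in>?I. v - u) \<ge> 0" using bd by (intro sum_nonneg) auto
      ultimately have "(\<Sum>(u, v)\<in>?I. v - u) < \<delta>" by (simp add: ennreal_less_iff)
      then have "(\<Sum>(c, d)\<in>?I. norm (F d - F c)) < \<epsilon>" by (rule \<delta>(2)[OF fam])
      moreover have "(\<Sum>(c, d)\<in>?I. norm (F d - F c)) = (\<Sum>K\<in>C. norm (F (Sup K) - F (Inf K)))"
        by (subst interval_family_image(2)[OF C(2) bd disj]) auto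
      moreover have "(\<Sum>K\<in>C. emeasure ?M K) = (\<Sum>K\<in>C. ennreal (norm (F (Sup K) - F (Inf K))))"
      proof (rule sum.cong)
        fix K assume "K \<in> C"
        note b = bd[OF this]
        have "emeasure ?M {Inf K..Sup K} = ennreal (G (Sup K) - G (Inf K))"
          by (rule emeasure_interval_measure_Icc) (use b G in auto)
        also have "\<dots> = ennreal (norm (F (Sup K) - F (Inf K)))"
          using b mono[of "Inf K" "Sup K"] by (simp add: G(3))
        finally show "emeasure ?M K = ennreal (norm (F (Sup K) - F (Inf K)))"
          using Kform C(1) \<open>K \<in> C\<close> by (metis subsetD)
      qed simp
      ultimately show ?thesis by (simp add: sum_ennreal ennreal_leI)
    qed
    have setsD: "K \<in> sets ?M" if "K \<in> D" for K
      using Kform[OF that] by (metis atLeastAtMost_borel sets_interval_measure)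
    show ?thesis
    proof (cases "D = {}")
      case True
      then show ?thesis using D(4) by simp
    next
      case False
      let ?U = "\<lambda>n. \<Union>(from_nat_into D ` {..n})"
      have sub: "from_nat_into D ` A \<subseteq> D" for A using from_nat_into[OF False] by auto
      have "N \<subseteq> (\<Union>n. ?U n)"
      proof
        fix x assume "x \<in> N"
        then obtain K where K: "K \<in> D" "x \<in> K" using D(4) by blast
        then obtain n where "from_nat_into D n = K" using from_nat_into_surj[OF D(1)] by blast
        then show "x \<in> (\<Union>n. ?U n)" using K by blast
      qed
      moreover have setsU: "?U n \<in> sets ?M" for n
        using sub setsD by (intro sets.finite_Union) auto
      ultimately have "emeasure ?M N \<le> emeasure ?M (\<Union>n. ?U n)"
        by (intro emeasure_mono) auto
      also have "\<dots> = (SUP n. emeasure ?M (?U n))"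
      proof (rule SUP_emeasure_incseq[symmetric])
        show "range ?U \<subseteq> sets ?M" using setsU by blast
        show "incseq ?U" unfolding incseq_def by (intro allI impI Union_mono image_mono) simp
      qed
      also have "\<dots> \<le> ennreal \<epsilon>"
      proof (rule SUP_least)
        fix n
        have "emeasure ?M (?U n) \<le> (\<Sum>K\<in>from_nat_into D ` {..n}. emeasure ?M K)"
        proof -
          have "from_nat_into D ` {..n} \<subseteq> sets ?M" using sub setsD by blast
          then show ?thesis
            using emeasure_subadditive_finite[of "from_nat_into D ` {..n}" "\<lambda>K. K" ?M] by simp
        qed
        also have "\<dots> \<le> ennreal \<epsilon>" using fin[OF sub] by simp
        finally show "emeasure ?M (?U n) \<le> ennreal \<epsilon>" .
      qed
      finally show ?thesis .
    qed
  qed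
  then have "emeasure ?M N \<le> 0" by (metis add_0 ennreal_le_epsilon)
  then show ?thesis by simp
qed

text \<open>
  The density is the Radon-Nikodym derivative of the Stieltjes measure of \<open>F\<close>, extended by constants
  and restricted to \<open>[a, b]\<close>.
\<close>

lemma mono_abs_continuous_density:
  fixes F :: "real \<Rightarrow> real"
  assumes "a \<le> b" and mono: "\<And>x y. a \<le> x \<Longrightarrow> x \<le> y \<Longrightarrow> y \<le> b \<Longrightarrow> F x \<le> F y"
    and ac: "abs_continuous_on_interval a b F"
  obtains p where "integrable lborel p" "\<And>x. x \<in> {a..b} \<Longrightarrow> F x = F a + (LINT t:{a..x}|lborel. p t :: real)"
proof -
  define G where "G x = F (max a (min b x))" for x
  have G: "\<And>x y. x \<le> y \<Longrightarrow> G x \<le> G y" "continuous_on UNIV G" "\<And>x. x \<in> {a..b} \<Longrightarrow> G x = F x"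
  proof -
    show "G x \<le> G y" if "x \<le> y" for x y
      unfolding G_def using that \<open>a \<le> b\<close> by (intro mono) auto
    show "continuous_on UNIV G" unfolding G_def
      by (rule continuous_on_compose2[OF abs_continuous_on_imp_continuous_on[OF ac]])
         (use \<open>a \<le> b\<close> in \<open>auto intro!: continuous_intros\<close>)
  qed (auto simp: G_def)
  let ?M = "interval_measure G"
  let ?R = "density ?M (indicator {a..b})"
  have emR: "emeasure ?R A = emeasure ?M ({a..b} \<inter> A)" if "A \<in> sets borel" for A
    using that by (simp add: emeasure_restricted)
  have "absolutely_continuous lborel ?R"
    unfolding absolutely_continuous_def
  proof
    fix N :: "real set" assume N: "N \<in> null_sets lborel"
    then have "{a..b} \<inter> N \<in> null_sets lborel" by (intro null_set_Int1) auto
    then have "emeasure ?M ({a..b} \<inter> N) = 0"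
      by (intro stieltjes_measure_null[OF mono ac G]) auto
    then show "N \<in> null_sets ?R" using N by (auto simp: null_sets_def emR)
  qed
  then have "\<exists>q\<in>borel_measurable lborel. density lborel q = ?R"
    by (rule sigma_finite_measure.Radon_Nikodym[OF sigma_finite_lborel]) simp
  then obtain q where q: "q \<in> borel_measurable lborel" "density lborel q = ?R" by blast
  have qint: "(\<integral>\<^sup>+t. q t * indicator {a..x} t \<partial>lborel) = ennreal (F x - F a)" if "x \<in> {a..b}" for x
  proof -
    have "(\<integral>\<^sup>+t. q t * indicator {a..x} t \<partial>lborel) = emeasure ?R {a..x}"
      by (subst q(2)[symmetric], subst emeasure_density) (use q(1) in auto)
    also have "\<dots> = emeasure ?M {a..x}" 
    proof -
      have "{a..b} \<inter> {a..x} = {a..x}" using that by auto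
      then show ?thesis by (simp only: emR[OF atLeastAtMost_borel])
    qed
    also have "\<dots> = ennreal (F x - F a)"
      using that \<open>a \<le> b\<close> by (subst emeasure_interval_measure_Icc) (auto simp: G)
    finally show ?thesis .
  qed
  define q' where "q' t = q t * indicator {a..b} t" for t
  have [measurable]: "q' \<in> borel_measurable lborel" unfolding q'_def using q(1) by measurable
  have "(\<integral>\<^sup>+t. q' t \<partial>lborel) \<noteq> \<infinity>"
    using qint[of b] \<open>a \<le> b\<close> unfolding q'_def by simp
  then have AEfin: "AE t in lborel. q' t \<noteq> \<infinity>" by (intro nn_integral_PInf_AE) auto
  define p where "p t = enn2real (q' t)" for t
  have eq: "AE t in lborel. ennreal (p t) = q' t"
    using AEfin by eventually_elim (simp add: p_def less_top)
  have [measurable]: "p \<in> borel_measurable lborel" unfolding p_def by measurable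
  have p0: "p t \<ge> 0" for t by (simp add: p_def)
  have int: "integrable lborel p"
  proof (rule integrableI_nonneg)
    have "(\<integral>\<^sup>+t. p t \<partial>lborel) = (\<integral>\<^sup>+t. q' t \<partial>lborel)" by (rule nn_integral_cong_AE[OF eq])
    then show "(\<integral>\<^sup>+t. p t \<partial>lborel) < \<infinity>" using \<open>(\<integral>\<^sup>+t. q' t \<partial>lborel) \<noteq> \<infinity>\<close> by (simp add: less_top)
  qed (auto simp: p0)
  have "F x = F a + (LINT t:{a..x}|lborel. p t)" if x: "x \<in> {a..b}" for x
  proof -
    have "(\<integral>\<^sup>+t. ennreal (indicator {a..x} t *\<^sub>R p t) \<partial>lborel) = (\<integral>\<^sup>+t. q t * indicator {a..x} t \<partial>lborel)"
      by (rule nn_integral_cong_AE, use eq in eventually_elim)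
         (use x in \<open>auto simp: q'_def indicator_def\<close>)
    also have "\<dots> = ennreal (F x - F a)" by (rule qint[OF x])
    finally have "(LINT t:{a..x}|lborel. p t) = F x - F a"
      unfolding set_lebesgue_integral_def using mono[of a x] x p0
      by (subst integral_eq_nn_integral) auto
    then show ?thesis by simp
  qed
  with int that show thesis by blast
qed

text \<open>
  The real and the imaginary part are differences of the variation and an increasing absolutely
  continuous function.
\<close>

lemma abs_continuous_density:
  fixes f :: "real \<Rightarrow> complex"
  assumes "a \<le> b" and ac: "abs_continuous_on_interval a b f"
  obtains p where "integrable lborel p" "\<And>x. x \<in> {a..b} \<Longrightarrow> f x = f a + (LINT t:{a..x}|lborel. p t)"
proof -
  define V where "V x = variation f a x" for x
  have VAC: "abs_continuous_on_interval a b V"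
    unfolding V_def by (rule abs_continuous_on_variation[OF assms])
  have V: "norm (f y - f x) \<le> V y - V x" if "a \<le> x" "x \<le> y" "y \<le> b" for x y
    unfolding V_def by (rule norm_diff_le_variation_diff[OF assms that])
  have Vmono: "V x \<le> V y" if "a \<le> x" "x \<le> y" "y \<le> b" for x y
    using V[OF that] norm_ge_zero[of "f y - f x"] by linarith
  obtain p0 where p0: "integrable lborel p0" "\<And>x. x \<in> {a..b} \<Longrightarrow> V x = V a + (LINT t:{a..x}|lborel. p0 t)"
    using mono_abs_continuous_density[OF \<open>a \<le> b\<close> Vmono VAC] by blast
  have part: "\<exists>p. integrable lborel p \<and> (\<forall>x\<in>{a..b}. r (f x) = r (f a) + (LINT t:{a..x}|lborel. p t))"
    if r: "\<And>z w. r z - r w = r (z - w)" "\<And>z. \<bar>r z\<bar> \<le> norm z" for r :: "complex \<Rightarrow> real"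
  proof -
    have "abs_continuous_on_interval a b (\<lambda>x. r (f x))"
      by (rule abs_continuous_on_dominated[OF ac]) (simp add: r)
    then have ac': "abs_continuous_on_interval a b (\<lambda>x. V x - r (f x))"
      by (rule abs_continuous_on_diff[OF VAC])
    have mono': "V x - r (f x) \<le> V y - r (f y)" if "a \<le> x" "x \<le> y" "y \<le> b" for x y
      using V[OF that] r(1)[of "f y" "f x"] r(2)[of "f y - f x"] by linarith
    obtain p1 where p1: "integrable lborel p1"
      "\<And>x. x \<in> {a..b} \<Longrightarrow> V x - r (f x) = V a - r (f a) + (LINT t:{a..x}|lborel. p1 t)"
      using mono_abs_continuous_density[OF \<open>a \<le> b\<close> mono' ac'] by blast
    have "r (f x) = r (f a) + (LINT t:{a..x}|lborel. p0 t - p1 t)" if "x \<in> {a..b}" for x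
    proof -
      have "(LINT t:{a..x}|lborel. p0 t - p1 t) = (LINT t:{a..x}|lborel. p0 t) - (LINT t:{a..x}|lborel. p1 t)"
        by (intro set_integral_diff integrable_imp_set_integrable p0(1) p1(1)) auto
      then show ?thesis using p0(2)[OF that] p1(2)[OF that] by simp
    qed
    then show ?thesis 
      by (intro exI[of _ "\<lambda>t. p0 t - p1 t"] conjI ballI Bochner_Integration.integrable_diff p0(1) p1(1)) blast
  qed
  have "\<exists>p. integrable lborel p \<and> (\<forall>x\<in>{a..b}. Re (f x) = Re (f a) + (LINT t:{a..x}|lborel. p t))"
    by (rule part) (simp_all add: abs_Re_le_cmod)
  then obtain pr where pr: "integrable lborel pr"
    "\<And>x. x \<in> {a..b} \<Longrightarrow> Re (f x) = Re (f a) + (LINT t:{a..x}|lborel. pr t)" by blast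
  have "\<exists>p. integrable lborel p \<and> (\<forall>x\<in>{a..b}. Im (f x) = Im (f a) + (LINT t:{a..x}|lborel. p t))"
    by (rule part) (simp_all add: abs_Im_le_cmod)
  then obtain pi where pi: "integrable lborel pi"
    "\<And>x. x \<in> {a..b} \<Longrightarrow> Im (f x) = Im (f a) + (LINT t:{a..x}|lborel. pi t)" by blast
  let ?p = "\<lambda>t. complex_of_real (pr t) + \<i> * complex_of_real (pi t)"
  have int: "integrable lborel ?p" using pr(1) pi(1) by auto
  have "f x = f a + (LINT t:{a..x}|lborel. ?p t)" if x: "x \<in> {a..b}" for x
  proof -
    have i: "integrable lborel (\<lambda>t. indicator {a..x} t *\<^sub>R ?p t)"
      by (rule integrable_mult_indicator[OF _ int]) simp
    have "Re (LINT t:{a..x}|lborel. ?p t) = (LINT t:{a..x}|lborel. pr t)"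
      "Im (LINT t:{a..x}|lborel. ?p t) = (LINT t:{a..x}|lborel. pi t)"
      unfolding set_lebesgue_integral_def using i by (simp_all flip: integral_Re integral_Im)
    then show ?thesis using pr(2)[OF x] pi(2)[OF x] by (intro complex_eqI) auto
  qed
  with int that show thesis by blast
qed

section \<open>Indefinite integrals\<close>

lemma indefinite_integral_diff:
  fixes p :: "real \<Rightarrow> 'b::euclidean_space"
  assumes "integrable lborel p" "a \<le> x" "x \<le> y"
  shows "(LINT t:{a..y}|lborel. p t) - (LINT t:{a..x}|lborel. p t) = integral {x..y} p"
proof -
  have si: "set_integrable lborel {u..v} p" for u v
    using assms(1) by (rule integrable_imp_set_integrable) simp
  have "integral {a..x} p + integral {x..y} p = integral {a..y} p"
    using assms set_borel_integral_eq_integral(1)[OF si] by (intro Henstock_Kurzweil_Integration.integral_combine) auto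
  then show ?thesis by (simp add: set_borel_integral_eq_integral(2)[OF si] algebra_simps)
qed

text \<open>
  Lebesgue's differentiation theorem. The averages over \<open>[x, x + h]\<close> converge almost everywhere;
  applied to the reflected function, this also gives the averages over \<open>[x - h, x]\<close>, and so the
  two-sided derivative.
\<close>

lemma AE_has_vector_derivative_indefinite_integral:
  fixes p :: "real \<Rightarrow> 'b::euclidean_space"
  assumes int: "integrable lborel p"
  shows "AE x in lebesgue. x \<in> {a..b} \<longrightarrow>
    ((\<lambda>y. LINT t:{a..y}|lborel. p t) has_vector_derivative p x) (at x within {a..b})"
proof -
  have int': "integrable lborel (\<lambda>t. p (- t))"
    using lborel_integrable_real_affine[OF int, of "-1" 0] by simp
  have io: "q integrable_on cbox u v" if "integrable lborel q" for q :: "real \<Rightarrow> 'b" and u v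
    using set_borel_integral_eq_integral(1)[OF integrable_imp_set_integrable[OF that], of "cbox u v"] by simp
  obtain N1 where N1: "negligible N1" "\<And>x e. \<lbrakk>x \<notin> N1; 0 < e\<rbrakk> \<Longrightarrow>
      \<exists>d>0. \<forall>h. 0 < h \<and> h < d \<longrightarrow> norm (integral {x..x + h} p /\<^sub>R h - p x) < e"
    using integrable_ccontinuous_explicit[OF io[OF int]] by auto
  obtain N2 where N2: "negligible N2" "\<And>x e. \<lbrakk>x \<notin> N2; 0 < e\<rbrakk> \<Longrightarrow>
      \<exists>d>0. \<forall>h. 0 < h \<and> h < d \<longrightarrow> norm (integral {x..x + h} (\<lambda>t. p (- t)) /\<^sub>R h - p (- x)) < e"
    using integrable_ccontinuous_explicit[OF io[OF int']] by auto
  have "negligible (N1 \<union> uminus ` N2)"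
    using N1(1) N2(1) by (auto intro!: negligible_Un negligible_differentiable_image_negligible
      differentiable_on_minus differentiable_on_ident[unfolded id_def])
  then have "AE x in lebesgue. x \<notin> N1 \<union> uminus ` N2"
    unfolding negligible_iff_null_sets by (rule AE_not_in)
  then show ?thesis
  proof eventually_elim
    case (elim x)
    have "\<exists>d>0. \<forall>y\<in>{a..b}. norm (y - x) < d \<longrightarrow>
        norm ((LINT t:{a..y}|lborel. p t) - (LINT t:{a..x}|lborel. p t) - (y - x) *\<^sub>R p x) \<le> e * norm (y - x)"
      if x: "x \<in> {a..b}" and "e > 0" for e
    proof -
      obtain d1 where d1: "d1 > 0" "\<And>h. 0 < h \<Longrightarrow> h < d1 \<Longrightarrow> norm (integral {x..x + h} p /\<^sub>R h - p x) < e"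
        using N1(2)[of x e] elim \<open>e > 0\<close> by auto
      have "- x \<notin> N2" using elim by force
      then obtain d2 where d2: "d2 > 0"
        "\<And>h. 0 < h \<Longrightarrow> h < d2 \<Longrightarrow> norm (integral {- x..- x + h} (\<lambda>t. p (- t)) /\<^sub>R h - p x) < e"
        using N2(2)[of "- x" e] \<open>e > 0\<close> by auto
      have scale: "norm (I - h *\<^sub>R p x) \<le> e * h" if "h > 0" "norm (I /\<^sub>R h - p x) < e" for h and I :: 'b
      proof -
        have "I - h *\<^sub>R p x = h *\<^sub>R (I /\<^sub>R h - p x)" using \<open>h > 0\<close> by (simp add: algebra_simps)
        then have "norm (I - h *\<^sub>R p x) = h * norm (I /\<^sub>R h - p x)" using \<open>h > 0\<close> by simp
        also have "\<dots> \<le> h * e" using that by (intro mult_left_mono) auto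
        finally show ?thesis by (simp add: mult.commute)
      qed
      show ?thesis
      proof (intro exI[of _ "min d1 d2"] conjI ballI impI)
        fix y assume y: "y \<in> {a..b}" "norm (y - x) < min d1 d2"
        consider "y = x" | "y > x" | "y < x" by linarith
        then show "norm ((LINT t:{a..y}|lborel. p t) - (LINT t:{a..x}|lborel. p t) - (y - x) *\<^sub>R p x) \<le> e * norm (y - x)"
        proof cases
          case 2
          then have "norm (integral {x..x + (y - x)} p /\<^sub>R (y - x) - p x) < e"
            using y by (intro d1(2)) auto
          then show ?thesis
            using scale[of "y - x" "integral {x..y} p"] 2 x indefinite_integral_diff[OF int, of a x y] by simp
        next
          case 3
          then have "norm (integral {- x..- x + (x - y)} (\<lambda>t. p (- t)) /\<^sub>R (x - y) - p x) < e"
            using y by (intro d2(2)) auto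
          then have "norm (integral {y..x} p - (x - y) *\<^sub>R p x) \<le> e * (x - y)"
            using scale[of "x - y" "integral {y..x} p"] 3 by simp
          moreover have "(LINT t:{a..y}|lborel. p t) - (LINT t:{a..x}|lborel. p t) - (y - x) *\<^sub>R p x =
              - (integral {y..x} p - (x - y) *\<^sub>R p x)"
            using indefinite_integral_diff[OF int, of a y x] y 3 by (simp add: algebra_simps)
          ultimately show ?thesis using 3 by (simp only: norm_minus_cancel) simp
        qed simp
      qed (use d1 d2 in simp)
    qed
    then show ?case
      unfolding has_vector_derivative_def has_derivative_within_alt
      by (auto intro: bounded_linear_scaleR_left)
  qed
qed

lemma continuous_on_indefinite_integral:
  fixes p :: "real \<Rightarrow> 'b::euclidean_space"
  assumes "integrable lborel p"
  shows "continuous_on {a..b} (\<lambda>x. LINT t:{a..x}|lborel. p t)"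
proof -
  have si: "set_integrable lborel {u..v} p" for u v
    using assms by (rule integrable_imp_set_integrable) simp
  show ?thesis
    unfolding set_borel_integral_eq_integral(2)[OF si]
    by (rule indefinite_integral_continuous_1[OF set_borel_integral_eq_integral(1)[OF si]])
qed

lemma C1_density:
  fixes F :: "real \<Rightarrow> complex"
  assumes d: "\<And>x. x \<in> {a..b} \<Longrightarrow> (F has_vector_derivative f x) (at x within {a..b})"
    and c: "continuous_on {a..b} f"
  shows "integrable lborel (\<lambda>t. indicator {a..b} t *\<^sub>R f t)"
    and "x \<in> {a..b} \<Longrightarrow> F x = F a + (LINT t:{a..x}|lborel. indicator {a..b} t *\<^sub>R f t)"
proof -
  show "integrable lborel (\<lambda>t. indicator {a..b} t *\<^sub>R f t)"
    using c by (intro borel_integrable_compact) auto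
  assume x: "x \<in> {a..b}"
  have "(LINT t:{a..x}|lborel. indicator {a..b} t *\<^sub>R f t) = (LINT t:{a..x}|lborel. f t)"
    using x by (intro set_lebesgue_integral_cong) auto
  also have "\<dots> = F x - F a"
    unfolding set_lebesgue_integral_def
  proof (rule integral_FTC_Icc)
    show "continuous_on {a..x} f" using c x by (elim continuous_on_subset) auto
    fix t assume "a \<le> t" "t \<le> x"
    then show "(F has_vector_derivative f t) (at t within {a..x})"
      using d[of t] x by (auto elim: has_vector_derivative_within_subset)
  qed (use x in simp)
  finally show "F x = F a + (LINT t:{a..x}|lborel. indicator {a..b} t *\<^sub>R f t)" by simp
qed

text \<open>
  Since Lebesgue measure is complete, a function that agrees almost everywhere with a Borel
  integrable one needs no measurability of its own. This is what allows the derivative of an absolutely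
  continuous function, which is arbitrary on a null set, to stand in for a density.
\<close>

lemma AE_integral_cong_lebesgue:
  fixes f g :: "real \<Rightarrow> 'b::{banach, second_countable_topology}"
  assumes f: "integrable lborel f" and ae: "AE x in lebesgue. f x = g x"
  shows "integrable lebesgue g" and "integral\<^sup>L lebesgue g = integral\<^sup>L lborel f"
proof -
  have fint: "integrable lebesgue f"
    using f by (simp add: integrable_completion)
  then have fm: "f \<in> borel_measurable lebesgue" by auto
  have gm: "g \<in> borel_measurable lebesgue"
  proof (rule borel_measurableI)
    fix S :: "'b set" assume "open S"
    then have S: "f -` S \<inter> space lebesgue \<in> sets lebesgue"
      by (intro measurable_sets[OF fm]) auto
    show "g -` S \<inter> space lebesgue \<in> sets lebesgue"
      by (rule completion.in_sets_AE[OF _ S], use ae in eventually_elim) auto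
  qed
  show "integrable lebesgue g"
    by (rule integrable_cong_AE_imp[OF fint gm ae])
  have "integral\<^sup>L lebesgue f = integral\<^sup>L lebesgue g"
    by (rule integral_cong_AE[OF fm gm ae])
  then show "integral\<^sup>L lebesgue g = integral\<^sup>L lborel f"
    using f by (simp add: integral_completion)
qed

lemma AE_set_integral_cong_lebesgue:
  fixes f g :: "real \<Rightarrow> 'b::{banach, second_countable_topology}"
  assumes f: "set_integrable lborel S f" and ae: "AE x in lebesgue. x \<in> S \<longrightarrow> f x = g x"
  shows "set_integrable lebesgue S g" and "(LINT x:S|lebesgue. g x) = (LINT x:S|lborel. f x)"
proof -
  have "AE x in lebesgue. indicator S x *\<^sub>R f x = indicator S x *\<^sub>R g x"
    using ae by eventually_elim (auto simp: indicator_def)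
  from AE_integral_cong_lebesgue[OF f[unfolded set_integrable_def] this]
  show "set_integrable lebesgue S g" "(LINT x:S|lebesgue. g x) = (LINT x:S|lborel. f x)"
    by (simp_all add: set_integrable_def set_lebesgue_integral_def)
qed

section \<open>The triangular Fubini identity\<close>

text \<open>
  The integrand may be unbounded at both end points, as the kernel \<open>(\<phi> w - \<phi> t) powr (\<nu> - 1)\<close> is for
  \<open>\<nu> < 1\<close>; it suffices that its primitive is continuous up to them.
\<close>

lemma nn_integral_FTC_singular:
  fixes F f :: "real \<Rightarrow> real"
  assumes "u \<le> v" and cont: "continuous_on {u..v} F"
    and F: "\<And>w. u < w \<Longrightarrow> w < v \<Longrightarrow> (F has_real_derivative f w) (at w)"
    and f: "\<And>w. u < w \<Longrightarrow> w < v \<Longrightarrow> isCont f w"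
    and nonneg: "\<And>w. u < w \<Longrightarrow> w < v \<Longrightarrow> 0 \<le> f w"
  shows "(\<integral>\<^sup>+w. ennreal (indicator {u..v} w * f w) \<partial>lborel) = ennreal (F v - F u)"
proof (cases "u = v")
  case True
  have "AE w in lborel. w \<noteq> u" by (rule AE_lborel_singleton)
  then have "AE w in lborel. ennreal (indicator {u..v} w * f w) = 0"
    by eventually_elim (simp add: True)
  then have "(\<integral>\<^sup>+w. ennreal (indicator {u..v} w * f w) \<partial>lborel) = integral\<^sup>N lborel (\<lambda>w::real. 0)"
    by (rule nn_integral_cong_AE)
  then show ?thesis using True by simp
next
  case False
  then have "u < v" using \<open>u \<le> v\<close> by simp
  have lim: "(F \<longlongrightarrow> F u) (at_right u)" "(F \<longlongrightarrow> F v) (at_left v)"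
    using cont \<open>u < v\<close> by (simp_all add: continuous_on_Icc_at_rightD continuous_on_Icc_at_leftD)
  have FTC: "set_integrable lborel (einterval u v) f" "(LBINT x=u..v. f x) = F v - F u"
    using interval_integral_FTC_nonneg[of "ereal u" "ereal v" F f "F u" "F v"] \<open>u < v\<close> F f nonneg lim
    by (simp_all add: ereal_tendsto_simps)
  have int: "integrable lborel (\<lambda>w. indicator {u<..<v} w * f w)"
    using FTC(1) by (simp add: set_integrable_def)
  have ne: "AE w in lborel. w \<noteq> u" "AE w in lborel. w \<noteq> v" by (rule AE_lborel_singleton)+
  have "(\<integral>\<^sup>+w. ennreal (indicator {u..v} w * f w) \<partial>lborel) =
      (\<integral>\<^sup>+w. ennreal (indicator {u<..<v} w * f w) \<partial>lborel)"
    by (rule nn_integral_cong_AE, use ne in eventually_elim) (auto simp: indicator_def)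
  also have "\<dots> = ennreal (LINT w|lborel. indicator {u<..<v} w * f w)"
    using nonneg by (intro nn_integral_eq_integral[OF int]) (auto simp: indicator_def)
  also have "(LINT w|lborel. indicator {u<..<v} w * f w) = F v - F u"
    using FTC(2) \<open>u < v\<close> by (simp add: interval_lebesgue_integral_def set_lebesgue_integral_def)
  finally show ?thesis .
qed

text \<open>
  Interchange of the integrations over \<open>a \<le> t \<le> w \<le> x\<close> for a non-negative kernel whose mass
  \<open>M t = \<integral>\<^sub>t\<^sup>x K w t dw\<close> is bounded. The bound makes the double integral of \<open>\<bar>K w t p t\<bar>\<close> finite. Kernels
  with the same mass thus give the same iterated integral.
\<close>

lemma fubini_triangle:
  fixes K :: "real \<Rightarrow> real \<Rightarrow> real" and p :: "real \<Rightarrow> 'b::{banach, second_countable_topology}"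
  assumes [measurable]: "(\<lambda>(t, w). K w t) \<in> borel_measurable (lborel \<Otimes>\<^sub>M lborel)"
    and nonneg: "\<And>t w. a \<le> t \<Longrightarrow> t \<le> w \<Longrightarrow> w \<le> x \<Longrightarrow> 0 \<le> K w t"
    and mass: "\<And>t. t \<in> {a..x} \<Longrightarrow> (\<integral>\<^sup>+w. ennreal (indicator {t..x} w * K w t) \<partial>lborel) = ennreal (M t)"
    and M: "\<And>t. t \<in> {a..x} \<Longrightarrow> 0 \<le> M t \<and> M t \<le> B"
    and p: "integrable lborel p"
  shows "AE w in lborel. w \<in> {a..x} \<longrightarrow> set_integrable lborel {a..w} (\<lambda>t. K w t *\<^sub>R p t)"
    and "set_integrable lborel {a..x} (\<lambda>w. LINT t:{a..w}|lborel. K w t *\<^sub>R p t)"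
    and "(LINT w:{a..x}|lborel. LINT t:{a..w}|lborel. K w t *\<^sub>R p t) = (LINT t:{a..x}|lborel. M t *\<^sub>R p t)"
proof -
  define H where "H t w = (if a \<le> t \<and> t \<le> w \<and> w \<le> x then K w t *\<^sub>R p t else 0)" for t w
  have [measurable]: "p \<in> borel_measurable borel" using p by auto
  have meas [measurable]: "case_prod H \<in> borel_measurable (lborel \<Otimes>\<^sub>M lborel)"
    unfolding H_def by measurable
  have Hx: "H t w = (indicator {t..x} w * K w t) *\<^sub>R p t" if "t \<in> {a..x}" for t w
    using that by (auto simp: H_def indicator_def)
  have H0: "H t w = 0" if "t \<notin> {a..x}" for t w
    using that by (auto simp: H_def)
  have Kmeas [measurable]: "(\<lambda>w. K w t) \<in> borel_measurable borel" for t
    by measurable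
  have Kint: "integrable lborel (\<lambda>w. indicator {t..x} w * K w t)"
    and Kval: "(LINT w|lborel. indicator {t..x} w * K w t) = M t" if t: "t \<in> {a..x}" for t
  proof -
    have nn: "AE w in lborel. 0 \<le> indicator {t..x} w * K w t"
      using nonneg t by (auto simp: indicator_def)
    show "integrable lborel (\<lambda>w. indicator {t..x} w * K w t)"
      by (rule integrableI_nonneg) (use nn mass[OF t] in auto)
    show "(LINT w|lborel. indicator {t..x} w * K w t) = M t"
      by (subst integral_eq_nn_integral) (use nn mass[OF t] M[OF t] in auto)
  qed
  have Hint: "integrable lborel (H t)" for t
  proof (cases "t \<in> {a..x}")
    case True
    then show ?thesis unfolding Hx[OF True] by (intro integrable_scaleR_left) (rule Kint)
  next
    case False
    have "H t = (\<lambda>_. 0)" using H0[OF False] by (rule ext)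
    then show ?thesis by simp
  qed
  have Hval: "(LINT w|lborel. H t w) = indicator {a..x} t *\<^sub>R (M t *\<^sub>R p t)" for t
    by (cases "t \<in> {a..x}") (simp_all add: Hx H0 Kval Kint)
  have Hnorm: "(LINT w|lborel. norm (H t w)) \<le> B * norm (p t) \<and> 0 \<le> (LINT w|lborel. norm (H t w))" if "t \<in> {a..x}" for t
  proof -
    have "norm (H t w) = (indicator {t..x} w * K w t) * norm (p t)" for w
      using that nonneg[of t w] by (auto simp: Hx indicator_def)
    then have "(LINT w|lborel. norm (H t w)) = M t * norm (p t)"
      using that by (simp add: Kval Kint)
    then show ?thesis using M[OF that] by (simp add: mult_right_mono)
  qed
  have Hnorm': "norm (LINT w|lborel. norm (H t w)) \<le> norm (\<bar>B\<bar> * norm (p t))" for t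
  proof (cases "t \<in> {a..x}")
    case True
    have "B * norm (p t) \<le> \<bar>B\<bar> * norm (p t)" by (intro mult_right_mono) auto
    then show ?thesis using Hnorm[OF True] by simp
  qed (simp add: H0)
  have int: "integrable (lborel \<Otimes>\<^sub>M lborel) (case_prod H)"
  proof (rule lborel_pair.Fubini_integrable[OF meas])
    show "integrable lborel (\<lambda>t. LINT w|lborel. norm (case (t, w) of (t, w) \<Rightarrow> H t w))"
      by (rule Bochner_Integration.integrable_bound[of _ "\<lambda>t. \<bar>B\<bar> * norm (p t)"])
         (use p Hnorm' in auto)
    show "AE t in lborel. integrable lborel (\<lambda>w. case (t, w) of (t, w) \<Rightarrow> H t w)"
      using Hint by simp
  qed
  have Hw: "H t w = indicator {a..w} t *\<^sub>R K w t *\<^sub>R p t" if "w \<in> {a..x}" for t w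
    using that by (auto simp: H_def indicator_def)
  have Hw0: "H t w = 0" if "w \<notin> {a..x}" for t w
    using that by (auto simp: H_def)
  have eq: "(LINT t|lborel. H t w) = indicator {a..x} w *\<^sub>R (LINT t:{a..w}|lborel. K w t *\<^sub>R p t)" for w
    by (cases "w \<in> {a..x}") (simp_all add: Hw Hw0 set_lebesgue_integral_def)
  have "AE w in lborel. integrable lborel (\<lambda>t. H t w)" by (rule lborel_pair.AE_integrable_snd[OF int])
  then show "AE w in lborel. w \<in> {a..x} \<longrightarrow> set_integrable lborel {a..w} (\<lambda>t. K w t *\<^sub>R p t)"
    by eventually_elim (auto simp: Hw set_integrable_def)
  show "set_integrable lborel {a..x} (\<lambda>w. LINT t:{a..w}|lborel. K w t *\<^sub>R p t)"
    using lborel_pair.integrable_snd[OF int] unfolding set_integrable_def eq .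
  show "(LINT w:{a..x}|lborel. LINT t:{a..w}|lborel. K w t *\<^sub>R p t) = (LINT t:{a..x}|lborel. M t *\<^sub>R p t)"
    using lborel_pair.Fubini_integral[OF int] unfolding eq Hval by (simp add: set_lebesgue_integral_def)
qed

section \<open>Fractional integration with respect to an increasing function\<close>

text \<open>
  \<open>\<phi>\<close> plays the part of the integration variable: the substitution \<open>u = \<phi> x\<close> turns the operators
  below into the classical Riemann-Liouville ones. Keeping \<open>\<phi>\<close> explicit avoids transporting
  integrals along the substitution.
\<close>

locale increasing_reparametrization =
  fixes \<phi> \<phi>' :: "real \<Rightarrow> real" and a b \<nu> :: real
  assumes nu: "\<nu> > 0"
    and deriv: "\<And>x. x \<in> {a..b} \<Longrightarrow> (\<phi> has_real_derivative \<phi>' x) (at x within {a..b})"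
    and cont': "continuous_on {a..b} \<phi>'"
    and pos: "\<And>x. x \<in> {a..b} \<Longrightarrow> \<phi>' x > 0"
begin

definition fractional_integral :: "(real \<Rightarrow> complex) \<Rightarrow> real \<Rightarrow> complex" where
  "fractional_integral f x = rGamma \<nu> *\<^sub>R (LINT t:{a..x}|lborel. ((\<phi> x - \<phi> t) powr (\<nu> - 1) * \<phi>' t) *\<^sub>R f t)"

text \<open>
  The fractional integral of a density taken with respect to \<open>dt\<close> rather than \<open>d\<phi>\<close>; it is what becomes
  of \<open>fractional_integral f\<close> when \<open>f\<close> is replaced by its derivative with respect to \<open>\<phi>\<close>, which need not
  exist everywhere.
\<close>

definition kernel_transform :: "(real \<Rightarrow> complex) \<Rightarrow> real \<Rightarrow> complex" where
  "kernel_transform p x = rGamma \<nu> *\<^sub>R (LINT t:{a..x}|lborel. ((\<phi> x - \<phi> t) powr (\<nu> - 1)) *\<^sub>R p t)"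

lemma cont: "continuous_on {a..b} \<phi>"
  using deriv by (meson DERIV_continuous continuous_on_eq_continuous_within)

lemma deriv_at: "a < x \<Longrightarrow> x < b \<Longrightarrow> (\<phi> has_real_derivative \<phi>' x) (at x)"
  using deriv[of x] by (simp add: at_within_Icc_at)

lemma isCont_deriv: "a < x \<Longrightarrow> x < b \<Longrightarrow> isCont \<phi>' x"
  using cont' by (rule continuous_on_interior) (simp add: interior_atLeastAtMost_real)

lemma phi_less: "a \<le> x \<Longrightarrow> x < y \<Longrightarrow> y \<le> b \<Longrightarrow> \<phi> x < \<phi> y"
proof (rule DERIV_pos_imp_increasing_open[of x y])
  fix z assume "a \<le> x" "y \<le> b" "x < z" "z < y"
  then show "\<exists>d. (\<phi> has_real_derivative d) (at z) \<and> 0 < d"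
    using deriv_at[of z] pos[of z] by auto
qed (use continuous_on_subset[OF cont] in auto)

lemma phi_mono: "a \<le> x \<Longrightarrow> x \<le> y \<Longrightarrow> y \<le> b \<Longrightarrow> \<phi> x \<le> \<phi> y"
  using phi_less[of x y] by (cases "x = y") auto

text \<open>
  The kernels of the two iterated integrals below have the same mass: here the singularity sits at the
  lower end point, in the next lemma at the upper one.
\<close>

lemma kernel_mass_outer:
  assumes "a \<le> t" "t \<le> x" "x \<le> b"
  shows "(\<integral>\<^sup>+w. ennreal (indicator {t..x} w * ((\<phi> w - \<phi> t) powr (\<nu> - 1) * \<phi>' w)) \<partial>lborel)
    = ennreal ((\<phi> x - \<phi> t) powr \<nu> / \<nu>)"
proof -
  have "(\<integral>\<^sup>+w. ennreal (indicator {t..x} w * ((\<phi> w - \<phi> t) powr (\<nu> - 1) * \<phi>' w)) \<partial>lborel)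
    = ennreal ((\<phi> x - \<phi> t) powr \<nu> / \<nu> - (\<phi> t - \<phi> t) powr \<nu> / \<nu>)"
  proof (rule nn_integral_FTC_singular[OF \<open>t \<le> x\<close>])
    show "continuous_on {t..x} (\<lambda>w. (\<phi> w - \<phi> t) powr \<nu> / \<nu>)"
      using assms nu phi_mono by (intro continuous_intros continuous_on_powr' continuous_on_subset[OF cont]) auto
    fix w assume w: "t < w" "w < x"
    then have p: "\<phi> w - \<phi> t > 0" using phi_less[of t w] assms by auto
    have d: "(\<phi> has_real_derivative \<phi>' w) (at w)" using w assms by (intro deriv_at) auto
    have "((\<lambda>w. (\<phi> w - \<phi> t) powr \<nu>) has_real_derivative \<nu> * (\<phi> w - \<phi> t) powr (\<nu> - of_nat 1) * \<phi>' w) (at w)"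
      by (rule DERIV_fun_powr) (use p d in \<open>auto intro!: derivative_eq_intros\<close>)
    from DERIV_cdivide[OF this, of \<nu>] show "((\<lambda>w. (\<phi> w - \<phi> t) powr \<nu> / \<nu>) has_real_derivative (\<phi> w - \<phi> t) powr (\<nu> - 1) * \<phi>' w) (at w)"
      using nu by simp
    show "isCont (\<lambda>w. (\<phi> w - \<phi> t) powr (\<nu> - 1) * \<phi>' w) w"
      using p w assms DERIV_isCont[OF d] isCont_deriv[of w] by (intro continuous_intros) auto
    show "0 \<le> (\<phi> w - \<phi> t) powr (\<nu> - 1) * \<phi>' w" using pos[of w] w assms by simp
  qed
  then show ?thesis using nu by simp
qed

lemma kernel_mass_inner:
  assumes "a \<le> t" "t \<le> x" "x \<le> b"
  shows "(\<integral>\<^sup>+w. ennreal (indicator {t..x} w * ((\<phi> x - \<phi> w) powr (\<nu> - 1) * \<phi>' w)) \<partial>lborel)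
    = ennreal ((\<phi> x - \<phi> t) powr \<nu> / \<nu>)"
proof -
  have "(\<integral>\<^sup>+w. ennreal (indicator {t..x} w * ((\<phi> x - \<phi> w) powr (\<nu> - 1) * \<phi>' w)) \<partial>lborel)
    = ennreal (- ((\<phi> x - \<phi> x) powr \<nu> / \<nu>) - - ((\<phi> x - \<phi> t) powr \<nu> / \<nu>))"
  proof (rule nn_integral_FTC_singular[OF \<open>t \<le> x\<close>])
    show "continuous_on {t..x} (\<lambda>w. - ((\<phi> x - \<phi> w) powr \<nu> / \<nu>))"
      using assms nu phi_mono by (intro continuous_intros continuous_on_powr' continuous_on_subset[OF cont]) auto
    fix w assume w: "t < w" "w < x"
    then have p: "\<phi> x - \<phi> w > 0" using phi_less[of w x] assms by auto
    have d: "(\<phi> has_real_derivative \<phi>' w) (at w)" using w assms by (intro deriv_at) auto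
    have "((\<lambda>w. (\<phi> x - \<phi> w) powr \<nu>) has_real_derivative \<nu> * (\<phi> x - \<phi> w) powr (\<nu> - of_nat 1) * (- \<phi>' w)) (at w)"
      by (rule DERIV_fun_powr) (use p d in \<open>auto intro!: derivative_eq_intros\<close>)
    from DERIV_minus[OF DERIV_cdivide[OF this, of \<nu>]]
    show "((\<lambda>w. - ((\<phi> x - \<phi> w) powr \<nu> / \<nu>)) has_real_derivative (\<phi> x - \<phi> w) powr (\<nu> - 1) * \<phi>' w) (at w)"
      using nu by simp
    show "isCont (\<lambda>w. (\<phi> x - \<phi> w) powr (\<nu> - 1) * \<phi>' w) w"
      using p w assms DERIV_isCont[OF d] isCont_deriv[of w] by (intro continuous_intros) auto
    show "0 \<le> (\<phi> x - \<phi> w) powr (\<nu> - 1) * \<phi>' w" using pos[of w] w assms by simp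
  qed
  then show ?thesis using nu by simp
qed

lemma rGamma_div: "rGamma \<nu> / \<nu> = rGamma (\<nu> + 1)"
  using rGamma_plus1[of \<nu>] nu by (simp add: field_simps)

text \<open>
  Write \<open>f t = f a + \<integral>\<^sub>a\<^sup>t p\<close> inside the fractional integral. The constant contributes the power term.
  The rest is an iterated integral of \<open>p\<close> with kernel \<open>(\<phi> x - \<phi> w) powr (\<nu> - 1) * \<phi>' w\<close>, while
  \<open>\<integral> \<phi>' w (J p) w dw\<close> is one with kernel \<open>(\<phi> w - \<phi> t) powr (\<nu> - 1) * \<phi>' w\<close>; both kernels have mass
  \<open>(\<phi> x - \<phi> t) powr \<nu> / \<nu>\<close>. Fubini also supplies all the integrability claims.
\<close>

lemma fractional_integral_by_parts:
  assumes p: "integrable lborel p"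
    and f: "\<And>x. x \<in> {a..b} \<Longrightarrow> f x = f a + (LINT t:{a..x}|lborel. p t)"
    and x: "x \<in> {a..b}"
  shows "set_integrable lborel {a..x} (\<lambda>t. ((\<phi> x - \<phi> t) powr (\<nu> - 1) * \<phi>' t) *\<^sub>R f t)" (is ?A)
    and "AE w in lborel. w \<in> {a..x} \<longrightarrow>
      set_integrable lborel {a..w} (\<lambda>t. ((\<phi> w - \<phi> t) powr (\<nu> - 1)) *\<^sub>R p t)" (is ?B)
    and "set_integrable lborel {a..x} (\<lambda>w. \<phi>' w *\<^sub>R kernel_transform p w)" (is ?C)
    and "fractional_integral f x = (rGamma (\<nu> + 1) * (\<phi> x - \<phi> a) powr \<nu>) *\<^sub>R f a + (LINT w:{a..x}|lborel. \<phi>' w *\<^sub>R kernel_transform p w)" (is ?D)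
proof -
  \<comment> \<open>\<open>\<phi>\<close> and \<open>\<phi>'\<close> are arbitrary off \<open>[a, b]\<close>; cutting them off makes the kernels Borel measurable.\<close>
  define \<psi> \<psi>' where "\<psi> t = indicator {a..b} t *\<^sub>R \<phi> t" and "\<psi>' t = indicator {a..b} t *\<^sub>R \<phi>' t" for t
  have [measurable]: "\<psi> \<in> borel_measurable borel" "\<psi>' \<in> borel_measurable borel"
    unfolding \<psi>_def \<psi>'_def
    using borel_measurable_continuous_on_indicator[OF _ cont] borel_measurable_continuous_on_indicator[OF _ cont']
    by simp_all
  have \<psi>: "\<psi> t = \<phi> t" "\<psi>' t = \<phi>' t" if "t \<in> {a..b}" for t using that by (auto simp: \<psi>_def \<psi>'_def)
  define K1 where "K1 w t = (\<psi> w - \<psi> t) powr (\<nu> - 1) * \<psi>' w" for w t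
  define k where "k t = (\<phi> x - \<psi> t) powr (\<nu> - 1) * \<psi>' t" for t
  define M where "M t = (\<phi> x - \<phi> t) powr \<nu> / \<nu>" for t
  have [measurable]: "(\<lambda>(t, w). K1 w t) \<in> borel_measurable (lborel \<Otimes>\<^sub>M lborel)"
    "(\<lambda>(t, w). k w) \<in> borel_measurable (lborel \<Otimes>\<^sub>M lborel)" "k \<in> borel_measurable borel"
    unfolding K1_def k_def by measurable
  have nn1: "0 \<le> K1 w t" and nnk: "0 \<le> k w" if "a \<le> t" "t \<le> w" "w \<le> x" for t w
    using that x pos[of w] by (auto simp: K1_def k_def \<psi>)
  have mass1: "(\<integral>\<^sup>+w. ennreal (indicator {t..x} w * K1 w t) \<partial>lborel) = ennreal (M t)"
    and massk: "(\<integral>\<^sup>+w. ennreal (indicator {t..x} w * k w) \<partial>lborel) = ennreal (M t)" if t: "t \<in> {a..x}" for t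
  proof -
    have K1: "indicator {t..x} w * K1 w t = indicator {t..x} w * ((\<phi> w - \<phi> t) powr (\<nu> - 1) * \<phi>' w)"
      and k: "indicator {t..x} w * k w = indicator {t..x} w * ((\<phi> x - \<phi> w) powr (\<nu> - 1) * \<phi>' w)" for w
      using t x by (auto simp: indicator_def K1_def k_def \<psi>)
    show "(\<integral>\<^sup>+w. ennreal (indicator {t..x} w * K1 w t) \<partial>lborel) = ennreal (M t)"
      unfolding K1 M_def by (rule kernel_mass_outer) (use t x in auto)
    show "(\<integral>\<^sup>+w. ennreal (indicator {t..x} w * k w) \<partial>lborel) = ennreal (M t)"
      unfolding k M_def by (rule kernel_mass_inner) (use t x in auto)
  qed
  have M: "0 \<le> M t \<and> M t \<le> M a" if "t \<in> {a..x}" for t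
    using that x nu phi_mono[of a t] phi_mono[of t x]
    by (auto simp: M_def intro!: divide_right_mono powr_mono2)
  have T1: "AE w in lborel. w \<in> {a..x} \<longrightarrow> set_integrable lborel {a..w} (\<lambda>t. K1 w t *\<^sub>R p t)"
    "set_integrable lborel {a..x} (\<lambda>w. LINT t:{a..w}|lborel. K1 w t *\<^sub>R p t)"
    "(LINT w:{a..x}|lborel. LINT t:{a..w}|lborel. K1 w t *\<^sub>R p t) = (LINT t:{a..x}|lborel. M t *\<^sub>R p t)"
    by (rule fubini_triangle[where M = M and B = "M a"]; fact nn1 mass1 M p \<open>(\<lambda>(t, w). K1 w t) \<in> _\<close>)+
  have T2: "set_integrable lborel {a..x} (\<lambda>w. LINT t:{a..w}|lborel. k w *\<^sub>R p t)"
    "(LINT w:{a..x}|lborel. LINT t:{a..w}|lborel. k w *\<^sub>R p t) = (LINT t:{a..x}|lborel. M t *\<^sub>R p t)"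
    by (rule fubini_triangle[where K = "\<lambda>w t. k w" and M = M and B = "M a"];
        fact nnk massk M p \<open>(\<lambda>(t, w). k w) \<in> _\<close>)+
  have inner: "(LINT t:{a..w}|lborel. k w *\<^sub>R p t) = k w *\<^sub>R (f w - f a)" if "w \<in> {a..x}" for w
    using f[of w] that x by simp
  have kint: "set_integrable lborel {a..x} k"
    unfolding set_integrable_def
    by (rule integrableI_nonneg) (use massk[of a] x nnk[of a] in \<open>auto simp: indicator_def\<close>)
  have kval: "(LINT t:{a..x}|lborel. k t) = M a"
    unfolding set_lebesgue_integral_def
    by (subst integral_eq_nn_integral)
       (use massk[of a] M[of a] x nnk[of a] in \<open>auto simp: indicator_def[of "{a..x}"]\<close>)
  have kfa: "(LINT t:{a..x}|lborel. k t *\<^sub>R f a) = M a *\<^sub>R f a"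
    using integral_scaleR_left[of "f a" lborel "\<lambda>t. indicator {a..x} t *\<^sub>R k t"] kint kval
    by (simp add: set_integrable_def set_lebesgue_integral_def)
  have int1: "set_integrable lborel {a..x} (\<lambda>t. k t *\<^sub>R f a)"
    using kint by (rule set_integrable_scaleR_left)
  have "set_integrable lborel {a..x} (\<lambda>w. LINT t:{a..w}|lborel. k w *\<^sub>R p t) \<longleftrightarrow>
      set_integrable lborel {a..x} (\<lambda>w. k w *\<^sub>R (f w - f a))"
    by (intro set_integrable_cong refl inner)
  then have int2: "set_integrable lborel {a..x} (\<lambda>w. k w *\<^sub>R (f w - f a))"
    using T2(1) by simp
  have val2: "(LINT w:{a..x}|lborel. k w *\<^sub>R (f w - f a)) = (LINT t:{a..x}|lborel. M t *\<^sub>R p t)"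
  proof -
    have "(LINT w:{a..x}|lborel. k w *\<^sub>R (f w - f a)) = (LINT w:{a..x}|lborel. LINT t:{a..w}|lborel. k w *\<^sub>R p t)"
      by (rule set_lebesgue_integral_cong) (simp, intro allI impI inner[symmetric])
    then show ?thesis using T2(2) by (rule trans)
  qed
  have kf: "((\<phi> x - \<phi> t) powr (\<nu> - 1) * \<phi>' t) *\<^sub>R f t = k t *\<^sub>R f a + k t *\<^sub>R (f t - f a)" if "t \<in> {a..x}" for t
    using that x by (simp add: k_def \<psi> scaleR_diff_right)
  have "?A \<longleftrightarrow> set_integrable lborel {a..x} (\<lambda>t. k t *\<^sub>R f a + k t *\<^sub>R (f t - f a))"
    by (intro set_integrable_cong refl kf)
  then show ?A using set_integral_add(1)[OF int1 int2] by simp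
  have "(LINT t:{a..x}|lborel. ((\<phi> x - \<phi> t) powr (\<nu> - 1) * \<phi>' t) *\<^sub>R f t) =
      (LINT t:{a..x}|lborel. k t *\<^sub>R f a + k t *\<^sub>R (f t - f a))"
    by (intro set_lebesgue_integral_cong) (auto simp: kf)
  also have "\<dots> = M a *\<^sub>R f a + (LINT t:{a..x}|lborel. M t *\<^sub>R p t)"
    by (subst set_integral_add(2)[OF int1 int2]) (simp add: val2 kfa)
  finally have If: "(LINT t:{a..x}|lborel. ((\<phi> x - \<phi> t) powr (\<nu> - 1) * \<phi>' t) *\<^sub>R f t) =
      M a *\<^sub>R f a + (LINT t:{a..x}|lborel. M t *\<^sub>R p t)" .
  have K1J: "K1 w t *\<^sub>R p t = \<phi>' w *\<^sub>R ((\<phi> w - \<phi> t) powr (\<nu> - 1) *\<^sub>R p t)"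
    if "w \<in> {a..x}" "t \<in> {a..w}" for w t
    using that x by (simp add: K1_def \<psi> mult.commute)
  have inner1: "rGamma \<nu> *\<^sub>R (LINT t:{a..w}|lborel. K1 w t *\<^sub>R p t) = \<phi>' w *\<^sub>R kernel_transform p w" if w: "w \<in> {a..x}" for w
  proof -
    have "(LINT t:{a..w}|lborel. K1 w t *\<^sub>R p t) =
        (LINT t:{a..w}|lborel. \<phi>' w *\<^sub>R ((\<phi> w - \<phi> t) powr (\<nu> - 1) *\<^sub>R p t))"
      by (intro set_lebesgue_integral_cong) (auto simp: K1J[OF w])
    also have "\<dots> = \<phi>' w *\<^sub>R (LINT t:{a..w}|lborel. (\<phi> w - \<phi> t) powr (\<nu> - 1) *\<^sub>R p t)"
      by (rule set_integral_scaleR_right)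
    finally show ?thesis by (simp add: kernel_transform_def mult.commute)
  qed
  show ?B
    using T1(1)
  proof eventually_elim
    case (elim w)
    have "set_integrable lborel {a..w} (\<lambda>t. ((\<phi> w - \<phi> t) powr (\<nu> - 1)) *\<^sub>R p t)" if w: "w \<in> {a..x}"
    proof -
      have "set_integrable lborel {a..w} (\<lambda>t. K1 w t *\<^sub>R p t) \<longleftrightarrow>
          set_integrable lborel {a..w} (\<lambda>t. \<phi>' w *\<^sub>R ((\<phi> w - \<phi> t) powr (\<nu> - 1) *\<^sub>R p t))"
        by (intro set_integrable_cong refl K1J[OF w])
      then have "set_integrable lborel {a..w} (\<lambda>t. \<phi>' w *\<^sub>R ((\<phi> w - \<phi> t) powr (\<nu> - 1) *\<^sub>R p t))"
        using elim w by simp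
      from set_integrable_scaleR_right[OF this, of "1 / \<phi>' w"] show ?thesis
        using pos[of w] w x by simp
    qed
    then show ?case by simp
  qed
  have "set_integrable lborel {a..x} (\<lambda>w. rGamma \<nu> *\<^sub>R (LINT t:{a..w}|lborel. K1 w t *\<^sub>R p t)) \<longleftrightarrow> ?C"
    by (intro set_integrable_cong refl inner1)
  then show ?C using set_integrable_scaleR_right[OF T1(2)] by blast
  have "(LINT w:{a..x}|lborel. \<phi>' w *\<^sub>R kernel_transform p w) =
      (LINT w:{a..x}|lborel. rGamma \<nu> *\<^sub>R (LINT t:{a..w}|lborel. K1 w t *\<^sub>R p t))"
    by (intro set_lebesgue_integral_cong) (auto simp: inner1)
  also have "\<dots> = rGamma \<nu> *\<^sub>R (LINT t:{a..x}|lborel. M t *\<^sub>R p t)"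
    by (simp add: T1(3))
  finally show ?D
    by (simp add: fractional_integral_def If M_def scaleR_add_right flip: rGamma_div)
qed

text \<open>
  The reciprocal Gamma function absorbs the exponent that the differentiation brings down, without
  a case distinction: for \<open>r = 0\<close> the function is constant and the factor \<open>rGamma 0\<close> vanishes.
\<close>

lemma has_real_derivative_rGamma_power:
  assumes "a < x" "x \<le> b"
  shows "((\<lambda>y. rGamma (r + 1) * (\<phi> y - \<phi> a) powr r) has_real_derivative
    \<phi>' x * (rGamma r * (\<phi> x - \<phi> a) powr (r - 1))) (at x within {a..b})"
proof -
  have p: "\<phi> x - \<phi> a > 0" using phi_less[of a x] assms by simp
  have "((\<lambda>y. \<phi> y - \<phi> a) has_real_derivative \<phi>' x) (at x within {a..b})"
    using deriv[of x] assms by (auto intro!: derivative_eq_intros)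
  from DERIV_chain'[OF this has_real_derivative_powr[OF p, of r]]
  have "((\<lambda>y. (\<phi> y - \<phi> a) powr r) has_real_derivative r * (\<phi> x - \<phi> a) powr (r - 1) * \<phi>' x) (at x within {a..b})" .
  from DERIV_cmult[OF this, of "rGamma (r + 1)"] show ?thesis
    by (simp add: rGamma_plus1[symmetric, of r] mult_ac)
qed

lemma continuous_on_fractional_integral:
  assumes p: "integrable lborel p"
    and f: "\<And>x. x \<in> {a..b} \<Longrightarrow> f x = f a + (LINT t:{a..x}|lborel. p t)"
  shows "continuous_on {a..b} (fractional_integral f)"
proof (cases "a \<le> b")
  case True
  then have b: "b \<in> {a..b}" by simp
  note q = fractional_integral_by_parts(3)[OF p f b, unfolded set_integrable_def]
  have "continuous_on {a..b} (\<lambda>x. (rGamma (\<nu> + 1) * (\<phi> x - \<phi> a) powr \<nu>) *\<^sub>R f a +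
      (LINT w:{a..x}|lborel. indicator {a..b} w *\<^sub>R \<phi>' w *\<^sub>R kernel_transform p w))"
    using nu phi_mono by (intro continuous_intros continuous_on_powr' cont continuous_on_indefinite_integral q) auto
  then show ?thesis
  proof (rule continuous_on_eq)
    fix x assume x: "x \<in> {a..b}"
    have "(LINT w:{a..x}|lborel. indicator {a..b} w *\<^sub>R \<phi>' w *\<^sub>R kernel_transform p w) = (LINT w:{a..x}|lborel. \<phi>' w *\<^sub>R kernel_transform p w)"
      using x by (intro set_lebesgue_integral_cong) auto
    then show "(rGamma (\<nu> + 1) * (\<phi> x - \<phi> a) powr \<nu>) *\<^sub>R f a +
      (LINT w:{a..x}|lborel. indicator {a..b} w *\<^sub>R \<phi>' w *\<^sub>R kernel_transform p w) = fractional_integral f x"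
      using fractional_integral_by_parts(4)[OF p f x] by simp
  qed
qed simp

text \<open>
  Common core of the two differentiation theorems: they differ only in how the indefinite
  integral in the formula for \<open>fractional_integral f\<close> is differentiated.
\<close>

lemma fractional_integral_has_vector_derivative_aux:
  assumes p: "integrable lborel p"
    and f: "\<And>x. x \<in> {a..b} \<Longrightarrow> f x = f a + (LINT t:{a..x}|lborel. p t)"
    and x: "a < x" "x \<le> b"
    and d: "((\<lambda>x. LINT w:{a..x}|lborel. indicator {a..b} w *\<^sub>R \<phi>' w *\<^sub>R kernel_transform p w) has_vector_derivative
      \<phi>' x *\<^sub>R kernel_transform p x) (at x within {a..b})"
  shows "(fractional_integral f has_vector_derivative \<phi>' x *\<^sub>R ((rGamma \<nu> * (\<phi> x - \<phi> a) powr (\<nu> - 1)) *\<^sub>R f a + kernel_transform p x))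
    (at x within {a..b})"
proof -
  have "((\<lambda>y. rGamma (\<nu> + 1) * (\<phi> y - \<phi> a) powr \<nu>) has_vector_derivative
    \<phi>' x * (rGamma \<nu> * (\<phi> x - \<phi> a) powr (\<nu> - 1))) (at x within {a..b})"
    using has_real_derivative_rGamma_power[OF x, of \<nu>] by (simp add: has_real_derivative_iff_has_vector_derivative)
  from has_vector_derivative_add[OF bounded_linear.has_vector_derivative[OF bounded_linear_scaleR_left[of "f a"] this] d]
  have "((\<lambda>x. (rGamma (\<nu> + 1) * (\<phi> x - \<phi> a) powr \<nu>) *\<^sub>R f a +
      (LINT w:{a..x}|lborel. indicator {a..b} w *\<^sub>R \<phi>' w *\<^sub>R kernel_transform p w)) has_vector_derivative
      \<phi>' x *\<^sub>R ((rGamma \<nu> * (\<phi> x - \<phi> a) powr (\<nu> - 1)) *\<^sub>R f a + kernel_transform p x)) (at x within {a..b})"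
    by (simp add: scaleR_add_right mult_ac)
  then show ?thesis
  proof (rule has_vector_derivative_transform[rotated 2])
    fix x assume x: "x \<in> {a..b}"
    have "(LINT w:{a..x}|lborel. indicator {a..b} w *\<^sub>R \<phi>' w *\<^sub>R kernel_transform p w) = (LINT w:{a..x}|lborel. \<phi>' w *\<^sub>R kernel_transform p w)"
      using x by (intro set_lebesgue_integral_cong) auto
    then show "fractional_integral f x = (rGamma (\<nu> + 1) * (\<phi> x - \<phi> a) powr \<nu>) *\<^sub>R f a +
      (LINT w:{a..x}|lborel. indicator {a..b} w *\<^sub>R \<phi>' w *\<^sub>R kernel_transform p w)"
      using fractional_integral_by_parts(4)[OF p f x] by simp
  qed (use x in auto)
qed

lemma AE_fractional_integral_has_vector_derivative:
  assumes p: "integrable lborel p"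
    and f: "\<And>x. x \<in> {a..b} \<Longrightarrow> f x = f a + (LINT t:{a..x}|lborel. p t)"
  shows "AE x in lebesgue. a < x \<and> x \<le> b \<longrightarrow>
    set_integrable lborel {a..x} (\<lambda>t. ((\<phi> x - \<phi> t) powr (\<nu> - 1)) *\<^sub>R p t) \<and>
    (fractional_integral f has_vector_derivative \<phi>' x *\<^sub>R ((rGamma \<nu> * (\<phi> x - \<phi> a) powr (\<nu> - 1)) *\<^sub>R f a + kernel_transform p x))
      (at x within {a..b})"
proof (cases "a \<le> b")
  case True
  then have b: "b \<in> {a..b}" by simp
  have "AE w in lebesgue. w \<in> {a..b} \<longrightarrow>
      set_integrable lborel {a..w} (\<lambda>t. ((\<phi> w - \<phi> t) powr (\<nu> - 1)) *\<^sub>R p t)"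
    by (rule AE_completion[OF fractional_integral_by_parts(2)[OF p f b]])
  moreover have "integrable lborel (\<lambda>w. indicator {a..b} w *\<^sub>R \<phi>' w *\<^sub>R kernel_transform p w)"
    using fractional_integral_by_parts(3)[OF p f b] by (simp add: set_integrable_def)
  note AE_has_vector_derivative_indefinite_integral[OF this, of a b]
  ultimately show ?thesis
  proof eventually_elim
    case (elim x)
    then show ?case using fractional_integral_has_vector_derivative_aux[OF p f, of x] by auto
  qed
next
  case False
  then show ?thesis by (intro AE_I2) auto
qed

text \<open>
  If \<open>f\<close> has the derivative \<open>g\<close> with respect to \<open>\<phi>\<close> and \<open>g\<close> is an indefinite integral, the integrand in
  the formula for \<open>fractional_integral f\<close> is \<open>\<phi>' * fractional_integral g\<close>, which is continuous. So the
  derivative exists at every point of \<open>(a, b]\<close>, the end point \<open>b\<close> included. At \<open>a\<close> the power term is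
  in general not differentiable.
\<close>

lemma fractional_integral_has_vector_derivative:
  assumes p: "integrable lborel p"
    and f: "\<And>x. x \<in> {a..b} \<Longrightarrow> f x = f a + (LINT t:{a..x}|lborel. p t)"
    and pg: "\<And>x. x \<in> {a..b} \<Longrightarrow> p x = \<phi>' x *\<^sub>R g x"
    and q: "integrable lborel q"
    and g: "\<And>x. x \<in> {a..b} \<Longrightarrow> g x = g a + (LINT t:{a..x}|lborel. q t)"
    and x: "a < x" "x \<le> b"
  shows "(fractional_integral f has_vector_derivative \<phi>' x *\<^sub>R ((rGamma \<nu> * (\<phi> x - \<phi> a) powr (\<nu> - 1)) *\<^sub>R f a + fractional_integral g x))
    (at x within {a..b})"
proof -
  have transform_eq: "kernel_transform p w = fractional_integral g w" if "w \<in> {a..b}" for w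
  proof -
    have "(LINT t:{a..w}|lborel. ((\<phi> w - \<phi> t) powr (\<nu> - 1)) *\<^sub>R p t) =
        (LINT t:{a..w}|lborel. ((\<phi> w - \<phi> t) powr (\<nu> - 1) * \<phi>' t) *\<^sub>R g t)"
      using that by (intro set_lebesgue_integral_cong) (auto simp: pg)
    then show ?thesis by (simp add: fractional_integral_def kernel_transform_def)
  qed
  let ?h = "\<lambda>w. indicator {a..b} w *\<^sub>R \<phi>' w *\<^sub>R kernel_transform p w"
  have b: "b \<in> {a..b}" using x by simp
  have int: "integrable lborel ?h"
    using fractional_integral_by_parts(3)[OF p f b] by (simp add: set_integrable_def)
  have c: "continuous_on {a..b} (\<lambda>w. \<phi>' w *\<^sub>R fractional_integral g w)"
    by (intro continuous_intros cont' continuous_on_fractional_integral[OF q g])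
  have ceq: "continuous_on {a..b} ?h"
    by (rule continuous_on_eq[OF c]) (simp add: transform_eq)
  have "((\<lambda>x. integral {a..x} ?h) has_vector_derivative ?h x) (at x within {a..b})"
    using x by (intro integral_has_vector_derivative ceq) auto
  moreover have "(LINT w:{a..y}|lborel. ?h w) = integral {a..y} ?h" for y
    by (intro set_borel_integral_eq_integral(2) integrable_imp_set_integrable int) simp
  ultimately have "((\<lambda>x. LINT w:{a..x}|lborel. ?h w) has_vector_derivative \<phi>' x *\<^sub>R kernel_transform p x) (at x within {a..b})"
    using x by simp
  from fractional_integral_has_vector_derivative_aux[OF p f x this] show ?thesis
    using transform_eq[of x] x by simp
qed

text \<open>
  The inductive step for the iterated derivative: differentiating once more lowers the exponents of the
  accumulated powers by one, and the boundary term of \<open>f\<close> joins them as the summand \<open>k = j\<close>.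
\<close>

lemma has_vector_derivative_add_powers:
  fixes c :: "nat \<Rightarrow> complex"
  assumes x: "a < x" "x \<le> b"
    and d: "(f has_vector_derivative \<phi>' x *\<^sub>R ((rGamma \<nu> * (\<phi> x - \<phi> a) powr (\<nu> - 1)) *\<^sub>R c j + V)) (at x within {a..b})"
  shows "((\<lambda>y. f y + (\<Sum>k<j. (rGamma (\<nu> + real k - real j + 1) * (\<phi> y - \<phi> a) powr (\<nu> + real k - real j)) *\<^sub>R c k))
    has_vector_derivative \<phi>' x *\<^sub>R (V + (\<Sum>k<Suc j. (rGamma (\<nu> + real k - real (Suc j) + 1) *
      (\<phi> x - \<phi> a) powr (\<nu> + real k - real (Suc j))) *\<^sub>R c k))) (at x within {a..b})"
proof -
  have "((\<lambda>y. (rGamma (\<nu> + real k - real j + 1) * (\<phi> y - \<phi> a) powr (\<nu> + real k - real j)) *\<^sub>R c k)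
    has_vector_derivative (\<phi>' x * (rGamma (\<nu> + real k - real j) * (\<phi> x - \<phi> a) powr (\<nu> + real k - real j - 1))) *\<^sub>R c k)
    (at x within {a..b})" for k
    using bounded_linear.has_vector_derivative[OF bounded_linear_scaleR_left
      has_real_derivative_rGamma_power[OF x, of "\<nu> + real k - real j", unfolded has_real_derivative_iff_has_vector_derivative]] .
  from has_vector_derivative_add[OF d has_vector_derivative_sum[of "{..<j}", OF this]]
  show ?thesis
    by (simp add: scaleR_add_right scaleR_sum_right algebra_simps)
qed

end

section \<open>The iterated derivative and the representation formula\<close>

lemma mono_on_imp_deriv_within_nonneg:
  fixes f :: "real \<Rightarrow> real"
  assumes "a < b" "x \<in> {a..b}" and mono: "mono_on {a..b} f"
    and d: "(f has_real_derivative D) (at x within {a..b})"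
  shows "0 \<le> D"
proof (rule tendsto_lowerbound)
  show "((\<lambda>y. (f y - f x) / (y - x)) \<longlongrightarrow> D) (at x within {a..b})"
    using d by (simp add: has_field_derivative_iff)
  have "0 \<le> (f y - f x) / (y - x)" if "y \<in> {a..b}" for y
    using monotone_onD[OF mono, of x y] monotone_onD[OF mono, of y x] assms(2) that
    by (cases "x \<le> y") (auto intro: divide_nonneg_nonneg divide_nonpos_nonpos)
  then show "\<forall>\<^sub>F y in at x within {a..b}. 0 \<le> (f y - f x) / (y - x)"
    by (simp add: eventually_at_filter)
  show "at x within {a..b} \<noteq> bot"
    using assms(1,2) by (simp add: trivial_limit_within)
qed

lemma delta_exists_imp_differentiable:
  assumes "delta_exists a b \<Psi> \<Psi>' m f x" "k < m"
  shows "delta_pow a b \<Psi> \<Psi>' k f differentiable (at x within {a..b})"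
  using assms by (induction m) (auto simp: less_Suc_eq)

text \<open>
  Derivatives at a point \<open>x > a\<close> depend only on values near \<open>x\<close>, hence knowing the iterates on
  \<open>(a, b]\<close> is enough, whatever happens at \<open>a\<close>.
\<close>

lemma delta_pow_Suc_on_half_open:
  assumes "a < b" "a < x" "x \<le> b" and nz: "\<Psi> x \<noteq> 0" "\<Psi>' x \<noteq> 0"
    and ex: "\<And>y. a < y \<Longrightarrow> y \<le> b \<Longrightarrow> delta_exists a b \<Psi> \<Psi>' j F y"
    and eq: "\<And>y. a < y \<Longrightarrow> y \<le> b \<Longrightarrow> delta_pow a b \<Psi> \<Psi>' j F y = R y"
    and R: "(R has_vector_derivative (\<Psi>' x / \<Psi> x) *\<^sub>R D) (at x within {a..b})"
  shows "delta_exists a b \<Psi> \<Psi>' (Suc j) F x" and "delta_pow a b \<Psi> \<Psi>' (Suc j) F x = D"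
proof -
  have d: "(delta_pow a b \<Psi> \<Psi>' j F has_vector_derivative (\<Psi>' x / \<Psi> x) *\<^sub>R D) (at x within {a..b})"
    by (rule has_vector_derivative_transform_within[OF R, of "x - a"])
       (use assms(2,3) in \<open>auto simp: dist_real_def intro!: eq[symmetric]\<close>)
  have "\<forall>\<^sub>F y in at x within {a..b}. delta_exists a b \<Psi> \<Psi>' j F y"
    unfolding eventually_at
    by (rule exI[of _ "x - a"]) (use assms(2,3) in \<open>auto simp: dist_real_def intro!: ex\<close>)
  then show "delta_exists a b \<Psi> \<Psi>' (Suc j) F x"
    using ex[OF assms(2,3)] differentiableI_vector[OF d] by simp
  have "vector_derivative (delta_pow a b \<Psi> \<Psi>' j F) (at x within {a..b}) = (\<Psi>' x / \<Psi> x) *\<^sub>R D"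
    by (rule vector_derivative_within_closed_interval) (use assms d in auto)
  then show "delta_pow a b \<Psi> \<Psi>' (Suc j) F x = D" using nz by simp
qed

theorem theorem4p7:
  fixes a b \<mu> s :: real and n :: nat
    and \<Psi> \<Psi>' :: "real \<Rightarrow> real" and g :: "real \<Rightarrow> complex"
    and gk :: "nat \<Rightarrow> real \<Rightarrow> complex"
  assumes "a < b"
    and "\<mu> > 0"
    and "n = nat \<lfloor>\<mu>\<rfloor> + 1"
    and "\<And>x. x \<in> {a..b} \<Longrightarrow> (\<Psi> has_real_derivative \<Psi>' x) (at x within {a..b})"
    and "continuous_on {a..b} \<Psi>'"
    and "mono_on {a..b} \<Psi>"
    and "\<And>x. x \<in> {a..b} \<Longrightarrow> \<Psi> x > 0"
    and "\<And>x. x \<in> {a..b} \<Longrightarrow> \<Psi>' x \<noteq> 0"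
    and "g \<in> AC_delta a b \<Psi> \<Psi>' s n"
    and "\<And>k. gk k = delta_pow a b \<Psi> \<Psi>' k (\<lambda>x. (\<Psi> x powr s) *\<^sub>R g x)"
  shows "AE x\<in>{a..b} in lebesgue.
    hadamard_deriv_exists a b \<mu> s \<Psi> \<Psi>' g x \<and>
    set_integrable lebesgue {a..x}
      (\<lambda>t. (ln (\<Psi> x / \<Psi> t) powr (real n - \<mu> - 1)) *\<^sub>R
           vector_derivative (gk (n - 1)) (at t within {a..b})) \<and>
    hadamard_deriv a b \<mu> s \<Psi> \<Psi>' g x =
      (\<Psi> x powr (- s)) *\<^sub>R
        ((1 / Gamma (real n - \<mu>)) *\<^sub>R
           (LINT t:{a..x}|lebesgue.
              (ln (\<Psi> x / \<Psi> t) powr (real n - \<mu> - 1)) *\<^sub>R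
              vector_derivative (gk (n - 1)) (at t within {a..b}))
         + (\<Sum>k = 0..n - 1.
              (rGamma (real k - \<mu> + 1) * ln (\<Psi> x / \<Psi> a) powr (real k - \<mu>)) *\<^sub>R gk k a))"
proof -
  note ab = assms(1) and n = assms(3) and d\<Psi> = assms(4) and pos\<Psi> = assms(7) and nz\<Psi>' = assms(8)
    and gk = assms(10)
  define \<nu> where "\<nu> = real n - \<mu>"
  define \<phi> where "\<phi> x = ln (\<Psi> x)" for x
  define \<phi>' where "\<phi>' x = \<Psi>' x / \<Psi> x" for x
  define g0 where "g0 x = (\<Psi> x powr s) *\<^sub>R g x" for x
  define m where "m = n - 1"
  have nm: "n = Suc m" using n by (simp add: m_def)
  have "\<nu> > 0" using n \<open>\<mu> > 0\<close> unfolding \<nu>_def by linarith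
  have cont\<Psi>: "continuous_on {a..b} \<Psi>"
    using d\<Psi> by (meson DERIV_continuous continuous_on_eq_continuous_within)
  interpret increasing_reparametrization \<phi> \<phi>' a b \<nu>
  proof
    show "(\<phi> has_real_derivative \<phi>' x) (at x within {a..b})" if "x \<in> {a..b}" for x
      unfolding \<phi>_def \<phi>'_def using d\<Psi>[OF that] pos\<Psi>[OF that] by (auto intro!: derivative_eq_intros)
    show "continuous_on {a..b} \<phi>'"
      unfolding \<phi>'_def using pos\<Psi> by (intro continuous_intros assms(5) cont\<Psi>) force
    show "\<phi>' x > 0" if "x \<in> {a..b}" for x
      unfolding \<phi>'_def
      using mono_on_imp_deriv_within_nonneg[OF ab that assms(6) d\<Psi>[OF that]] nz\<Psi>'[OF that] pos\<Psi>[OF that]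
      by simp
  qed fact
  have ln_div: "ln (\<Psi> x / \<Psi> t) = \<phi> x - \<phi> t" if "x \<in> {a..b}" "t \<in> {a..b}" for x t
    using pos\<Psi>[OF that(1)] pos\<Psi>[OF that(2)] by (simp add: \<phi>_def ln_div)

  have ex: "delta_exists a b \<Psi> \<Psi>' m g0 x" if "x \<in> {a..b}" for x
    using assms(9) that unfolding AC_delta_def m_def g0_def by simp
  have gk': "gk k = delta_pow a b \<Psi> \<Psi>' k g0" for k
    unfolding gk g0_def ..
  have ac: "abs_continuous_on_interval a b (gk m)"
    using assms(9) unfolding AC_delta_def gk m_def by simp
  have deriv_gk: "(gk k has_vector_derivative \<phi>' x *\<^sub>R gk (Suc k) x) (at x within {a..b})"
    if "k < m" "x \<in> {a..b}" for k x
  proof -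
    have "\<phi>' x *\<^sub>R gk (Suc k) x = vector_derivative (gk k) (at x within {a..b})"
      using pos\<Psi>[OF that(2)] nz\<Psi>'[OF that(2)] unfolding gk' by (simp add: \<phi>'_def)
    then show ?thesis
      using delta_exists_imp_differentiable[OF ex[OF that(2)] that(1)]
      by (simp add: gk' vector_derivative_works del: delta_pow.simps)
  qed
  have cont_gk: "continuous_on {a..b} (gk k)" if "k \<le> m" for k
  proof (cases "k = m")
    case True
    then show ?thesis using abs_continuous_on_imp_continuous_on[OF ac] by simp
  next
    case False
    then show ?thesis
      using deriv_gk[of k] that has_vector_derivative_continuous
      by (force simp: continuous_on_eq_continuous_within)
  qed
  obtain pm where pm: "integrable lborel pm"
    "\<And>x. x \<in> {a..b} \<Longrightarrow> gk m x = gk m a + (LINT t:{a..x}|lborel. pm t)"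
    using abs_continuous_density[OF less_imp_le[OF ab] ac] by blast
  \<comment> \<open>Densities of all the \<open>g\<^sub>k\<close>: for \<open>k < n - 1\<close> the continuous derivative, for \<open>k = n - 1\<close> Lebesgue's theorem.\<close>
  define p where "p k = (if k = m then pm else (\<lambda>t. indicator {a..b} t *\<^sub>R \<phi>' t *\<^sub>R gk (Suc k) t))" for k
  have p: "integrable lborel (p k)" "\<And>x. x \<in> {a..b} \<Longrightarrow> gk k x = gk k a + (LINT t:{a..x}|lborel. p k t)"
    if "k \<le> m" for k
  proof -
    have "integrable lborel (p k) \<and> (\<forall>x\<in>{a..b}. gk k x = gk k a + (LINT t:{a..x}|lborel. p k t))"
    proof (cases "k = m")
      case True
      then have "p k = pm" by (simp add: p_def)
      then show ?thesis unfolding \<open>k = m\<close> by (intro conjI ballI) (simp_all only: pm(1), rule pm(2))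
    next
      case False
      then have k: "k < m" using that by simp
      have pk: "p k = (\<lambda>t. indicator {a..b} t *\<^sub>R \<phi>' t *\<^sub>R gk (Suc k) t)"
        using False by (simp add: p_def)
      have c: "continuous_on {a..b} (\<lambda>t. \<phi>' t *\<^sub>R gk (Suc k) t)"
        using k by (intro continuous_intros cont' cont_gk) simp
      show ?thesis
        unfolding pk by (intro conjI ballI C1_density[OF deriv_gk[OF k] c])
    qed
    then show "integrable lborel (p k)" "\<And>x. x \<in> {a..b} \<Longrightarrow> gk k x = gk k a + (LINT t:{a..x}|lborel. p k t)"
      by blast+
  qed

  define F where "F y = (\<Psi> y powr s) *\<^sub>R hadamard_integral a \<nu> s \<Psi> \<Psi>' g y" for y
  \<comment> \<open>The weights \<open>(\<Psi> t / \<Psi> y) powr s\<close> separate: \<open>\<Psi> t powr s\<close> turns \<open>g\<close> into \<open>gk 0\<close>, the rest leaves the integral.\<close>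
  have integrand: "hadamard_integrand \<nu> s \<Psi> \<Psi>' g y t =
      (\<Psi> y powr (- s)) *\<^sub>R (((\<phi> y - \<phi> t) powr (\<nu> - 1) * \<phi>' t) *\<^sub>R gk 0 t)" if "y \<in> {a..b}" "t \<in> {a..y}" for y t
  proof -
    have t: "t \<in> {a..b}" using that by simp
    have "(\<Psi> t / \<Psi> y) powr s = \<Psi> t powr s * \<Psi> y powr (- s)"
      using pos\<Psi>[OF t] pos\<Psi>[OF that(1)] by (simp add: powr_divide powr_minus_divide)
    then show ?thesis
      by (simp add: hadamard_integrand_def ln_div[OF that(1) t] gk' g0_def \<phi>'_def mult_ac)
  qed
  have had: "hadamard_integral_exists a \<nu> s \<Psi> \<Psi>' g y \<and> F y = fractional_integral (gk 0) y" if y: "y \<in> {a..b}" for y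
  proof -
    have int: "set_integrable lborel {a..y} (\<lambda>t. (\<Psi> y powr (- s)) *\<^sub>R (((\<phi> y - \<phi> t) powr (\<nu> - 1) * \<phi>' t) *\<^sub>R gk 0 t))"
      using fractional_integral_by_parts(1)[OF p[of 0] y] by (intro set_integrable_scaleR_right) simp_all
    have ae: "AE t in lebesgue. t \<in> {a..y} \<longrightarrow>
        (\<Psi> y powr (- s)) *\<^sub>R (((\<phi> y - \<phi> t) powr (\<nu> - 1) * \<phi>' t) *\<^sub>R gk 0 t) = hadamard_integrand \<nu> s \<Psi> \<Psi>' g y t"
      using integrand[OF y] by simp
    note * = AE_set_integral_cong_lebesgue[OF int ae]
    have "(LINT t:{a..y}|lebesgue. hadamard_integrand \<nu> s \<Psi> \<Psi>' g y t) = (\<Psi> y powr (- s)) *\<^sub>R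
        (LINT t:{a..y}|lborel. ((\<phi> y - \<phi> t) powr (\<nu> - 1) * \<phi>' t) *\<^sub>R gk 0 t)"
      using *(2) set_integral_scaleR_right by (rule trans)
    then have "F y = fractional_integral (gk 0) y"
      using pos\<Psi>[OF y]
      by (simp add: F_def hadamard_integral_def fractional_integral_def rGamma_inverse_Gamma powr_minus divide_inverse)
    then show ?thesis
      using *(1) by (simp add: hadamard_integral_exists_def)
  qed

  \<comment> \<open>The value of the \<open>j\<close>-th iterate of \<open>F\<close> on \<open>(a, b]\<close>, for \<open>j \<le> n - 1\<close>.\<close>
  define R where "R j x = fractional_integral (gk j) x + (\<Sum>k<j. (rGamma (\<nu> + real k - real j + 1) *
    (\<phi> x - \<phi> a) powr (\<nu> + real k - real j)) *\<^sub>R gk k a)" for j x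
  have nz: "\<Psi> x \<noteq> 0" "\<Psi>' x \<noteq> 0" if "a < x" "x \<le> b" for x
    using pos\<Psi>[of x] nz\<Psi>'[of x] that by auto
  \<comment> \<open>At \<open>a\<close> itself the iterates need not exist, so the induction runs on the half-open interval.\<close>
  have iter: "delta_exists a b \<Psi> \<Psi>' j F x \<and> delta_pow a b \<Psi> \<Psi>' j F x = R j x"
    if "j \<le> m" "a < x" "x \<le> b" for j x
    using that
  proof (induction j arbitrary: x)
    case 0
    then show ?case using had[of x] by (simp add: R_def)
  next
    case (Suc j)
    then have j: "j < m" "j \<le> m" "Suc j \<le> m" by simp_all
    have "(fractional_integral (gk j) has_vector_derivative \<phi>' x *\<^sub>R ((rGamma \<nu> * (\<phi> x - \<phi> a) powr (\<nu> - 1)) *\<^sub>R gk j a +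
        fractional_integral (gk (Suc j)) x)) (at x within {a..b})"
      by (rule fractional_integral_has_vector_derivative[OF p[OF j(2)] _ p[OF j(3)]])
         (use j Suc.prems in \<open>auto simp: p_def\<close>)
    from has_vector_derivative_add_powers[where c = "\<lambda>k. gk k a" and j = j, OF Suc.prems(2,3) this]
    have "(R j has_vector_derivative (\<Psi>' x / \<Psi> x) *\<^sub>R R (Suc j) x) (at x within {a..b})"
      unfolding R_def \<phi>'_def .
    note step = delta_pow_Suc_on_half_open[where \<Psi> = \<Psi> and \<Psi>' = \<Psi>' and F = F and j = j and R = "R j" and
        D = "R (Suc j) x", OF ab Suc.prems(2,3) nz[OF Suc.prems(2,3)] _ _ this]
    show ?case
      by (intro conjI step) (use Suc.IH j in blast)+
  qed

  have "AE x in lebesgue. x \<in> {a..b} \<longrightarrow>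
      ((\<lambda>y. LINT t:{a..y}|lborel. p m t) has_vector_derivative p m x) (at x within {a..b})"
    by (rule AE_has_vector_derivative_indefinite_integral) (simp add: p)
  then have vd: "AE x in lebesgue. x \<in> {a..b} \<longrightarrow> p m x = vector_derivative (gk m) (at x within {a..b})"
  proof eventually_elim
    case (elim x)
    show ?case
    proof
      assume x: "x \<in> {a..b}"
      have "((\<lambda>y. gk m a + (LINT t:{a..y}|lborel. p m t)) has_vector_derivative 0 + p m x) (at x within {a..b})"
        using elim x by (intro has_vector_derivative_add has_vector_derivative_const) simp
      then have "((\<lambda>y. gk m a + (LINT t:{a..y}|lborel. p m t)) has_vector_derivative p m x) (at x within {a..b})"
        by (simp only: add_0)
      then have "(gk m has_vector_derivative p m x) (at x within {a..b})"
        by (rule has_vector_derivative_transform[rotated 2]) (use x in simp, rule p(2), simp_all)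
      then show "p m x = vector_derivative (gk m) (at x within {a..b})"
        by (rule vector_derivative_within_closed_interval[OF ab x, symmetric])
    qed
  qed
  have "AE x in lebesgue. x \<noteq> a"
    by (rule AE_completion[OF AE_lborel_singleton])
  moreover have "AE x in lebesgue. a < x \<and> x \<le> b \<longrightarrow>
      set_integrable lborel {a..x} (\<lambda>t. ((\<phi> x - \<phi> t) powr (\<nu> - 1)) *\<^sub>R p m t) \<and>
      (fractional_integral (gk m) has_vector_derivative \<phi>' x *\<^sub>R ((rGamma \<nu> * (\<phi> x - \<phi> a) powr (\<nu> - 1)) *\<^sub>R gk m a + kernel_transform (p m) x))
        (at x within {a..b})"
    by (rule AE_fractional_integral_has_vector_derivative) (rule p; simp)+
  ultimately show ?thesis
  proof eventually_elim
    case (elim x)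
    show ?case
    proof
      assume "x \<in> {a..b}"
      with elim have x: "a < x" "x \<le> b" "x \<in> {a..b}" by auto
      with elim have int: "set_integrable lborel {a..x} (\<lambda>t. ((\<phi> x - \<phi> t) powr (\<nu> - 1)) *\<^sub>R p m t)"
        and d: "(fractional_integral (gk m) has_vector_derivative \<phi>' x *\<^sub>R ((rGamma \<nu> * (\<phi> x - \<phi> a) powr (\<nu> - 1)) *\<^sub>R gk m a +
          kernel_transform (p m) x)) (at x within {a..b})" by auto
      let ?D = "kernel_transform (p m) x + (\<Sum>k<Suc m. (rGamma (\<nu> + real k - real (Suc m) + 1) *
        (\<phi> x - \<phi> a) powr (\<nu> + real k - real (Suc m))) *\<^sub>R gk k a)"
      have "(R m has_vector_derivative (\<Psi>' x / \<Psi> x) *\<^sub>R ?D) (at x within {a..b})"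
        using has_vector_derivative_add_powers[where c = "\<lambda>k. gk k a" and j = m, OF x(1,2) d] unfolding R_def \<phi>'_def .
      note step = delta_pow_Suc_on_half_open[where \<Psi> = \<Psi> and \<Psi>' = \<Psi>' and F = F and j = m and R = "R m" and
          D = ?D, OF ab x(1,2) nz[OF x(1,2)] _ _ this]
      have D: "delta_exists a b \<Psi> \<Psi>' n F x" "delta_pow a b \<Psi> \<Psi>' n F x = ?D"
        unfolding nm by (rule step; use iter in blast)+
      have "AE t in lebesgue. t \<in> {a..x} \<longrightarrow> ((\<phi> x - \<phi> t) powr (\<nu> - 1)) *\<^sub>R p m t =
          (ln (\<Psi> x / \<Psi> t) powr (\<nu> - 1)) *\<^sub>R vector_derivative (gk m) (at t within {a..b})"
        using vd by eventually_elim (use x in \<open>auto simp: ln_div\<close>)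
      note * = AE_set_integral_cong_lebesgue[OF int this]
      have transform: "kernel_transform (p m) x = (1 / Gamma \<nu>) *\<^sub>R (LINT t:{a..x}|lebesgue.
          (ln (\<Psi> x / \<Psi> t) powr (\<nu> - 1)) *\<^sub>R vector_derivative (gk m) (at t within {a..b}))"
        unfolding kernel_transform_def *(2) rGamma_inverse_Gamma inverse_eq_divide ..
      have "(\<Sum>k<Suc m. (rGamma (\<nu> + real k - real (Suc m) + 1) *
          (\<phi> x - \<phi> a) powr (\<nu> + real k - real (Suc m))) *\<^sub>R gk k a) =
        (\<Sum>k = 0..m. (rGamma (real k - \<mu> + 1) * ln (\<Psi> x / \<Psi> a) powr (real k - \<mu>)) *\<^sub>R gk k a)"
        using x ab by (intro sum.cong) (auto simp: \<nu>_def nm ln_div)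
      with D transform have "delta_pow a b \<Psi> \<Psi>' n F x = (1 / Gamma \<nu>) *\<^sub>R (LINT t:{a..x}|lebesgue.
          (ln (\<Psi> x / \<Psi> t) powr (\<nu> - 1)) *\<^sub>R vector_derivative (gk m) (at t within {a..b})) +
        (\<Sum>k = 0..m. (rGamma (real k - \<mu> + 1) * ln (\<Psi> x / \<Psi> a) powr (real k - \<mu>)) *\<^sub>R gk k a)"
        by simp
      moreover have "hadamard_deriv_exists a b \<mu> s \<Psi> \<Psi>' g x"
        using D(1) had unfolding hadamard_deriv_exists_def Let_def n[symmetric] \<nu>_def[symmetric] F_def by simp
      moreover have "hadamard_deriv a b \<mu> s \<Psi> \<Psi>' g x = (\<Psi> x powr (- s)) *\<^sub>R delta_pow a b \<Psi> \<Psi>' n F x"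
        unfolding hadamard_deriv_def Let_def n[symmetric] \<nu>_def[symmetric] F_def ..
      ultimately show "hadamard_deriv_exists a b \<mu> s \<Psi> \<Psi>' g x \<and>
        set_integrable lebesgue {a..x}
          (\<lambda>t. (ln (\<Psi> x / \<Psi> t) powr (real n - \<mu> - 1)) *\<^sub>R
               vector_derivative (gk (n - 1)) (at t within {a..b})) \<and>
        hadamard_deriv a b \<mu> s \<Psi> \<Psi>' g x =
          (\<Psi> x powr (- s)) *\<^sub>R
            ((1 / Gamma (real n - \<mu>)) *\<^sub>R
               (LINT t:{a..x}|lebesgue.
                  (ln (\<Psi> x / \<Psi> t) powr (real n - \<mu> - 1)) *\<^sub>R
                  vector_derivative (gk (n - 1)) (at t within {a..b}))
             + (\<Sum>k = 0..n - 1.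
                  (rGamma (real k - \<mu> + 1) * ln (\<Psi> x / \<Psi> a) powr (real k - \<mu>)) *\<^sub>R gk k a))"
        using *(1) unfolding \<nu>_def[symmetric] m_def[symmetric] by simp
    qed
  qed
qed

end
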